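(* Let $X\subset\mathbb{P}^4_{x_1,\dots,x_5}$ be the real cubic threefold given by $$(x_1^2+x_2^2)x_3+t_1x_3^3+x_3^2(t_2x_4+t_3x_5)+x_3(t_4x_4^2+t_5x_5^2+t_6x_4x_5)+x_4(x_4^2-x_5^2)=0,$$ where $(t_1,\dots,t_6)\in\mathbb{R}^6$ is general, and let $$D_1(x)=-x^4+(t_5-t_4)x^3+\left(t_4t_5-t_2-\tfrac14t_6^2\right)x^2+\left(t_2t_5-t_1-\tfrac12t_3t_6\right)x+t_1t_5-\tfrac14t_3^2\in\mathbb{R}[x].$$ Then $X(\mathbb{R})$ has two connected components if and only if $D_1$ has $4$ real roots and $t_5$ is greater than all of these roots.
   Context: "General" means that $(t_1,\dots,t_6)$ lies outside a suitable proper Zariski-closed subset of the parameter space; in particular $X$ has no real singular points, the singular locus of $X_{\mathbb{C}}$ consists of exactly the two points $[1:\pm i:0:0:0]$, each a $\mathsf{D}_4$-singularity (locally analytically $x^2+y^2+z^2w+w^3=0$), and the real roots of $D_1$ are simple. *)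

theory Defs
  imports "HOL-Analysis.Analysis" "HOL-Computational_Algebra.Polynomial"
begin

definition zariski_closed :: "(real ^ 'n) set \<Rightarrow> bool" where
  "zariski_closed Z \<longleftrightarrow>
     (\<exists>P. (\<forall>p\<in>P. real_polynomial_function p) \<and> Z = {t. \<forall>p\<in>P. p t = 0})"


text \<open>A point of projective space over the field \<open>'a\<close> is a line through the origin of
  \<open>'a ^ 'n\<close>; \<open>vec.span\<close> is the span with respect to the scalars \<open>'a\<close>
  (so the complex span for \<open>'a = complex\<close>).\<close>

definition proj_point :: "'a::field ^ 'n \<Rightarrow> ('a ^ 'n) set" where
  "proj_point x = vec.span {x}"

definition proj_space :: "('a::field ^ 'n) set set" where
  "proj_space = proj_point ` (- {0})"

text \<open>The quotient topology of real projective space, see \<open>quotient_map_proj_point\<close>.\<close>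

definition real_proj_topology :: "(real ^ 'n) set topology" where
  "real_proj_topology =
     topology (\<lambda>U. U \<subseteq> proj_space \<and> open {x. x \<noteq> 0 \<and> proj_point x \<in> U})"

lemma openin_real_proj_topology:
  "openin real_proj_topology U \<longleftrightarrow>
     U \<subseteq> proj_space \<and> open {x. x \<noteq> 0 \<and> proj_point x \<in> U}"
proof -
  have "istopology (\<lambda>U::(real ^ 'n) set set.
          U \<subseteq> proj_space \<and> open {x. x \<noteq> 0 \<and> proj_point x \<in> U})"
    unfolding istopology_def
  proof (intro conjI allI impI; (elim conjE)?)
    fix S T :: "(real ^ 'n) set set"
    assume S: "S \<subseteq> proj_space" "open {x. x \<noteq> 0 \<and> proj_point x \<in> S}"
      and T: "T \<subseteq> proj_space" "open {x. x \<noteq> 0 \<and> proj_point x \<in> T}"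
    show "S \<inter> T \<subseteq> proj_space" using S by blast
    have "{x. x \<noteq> 0 \<and> proj_point x \<in> S \<inter> T} =
        {x. x \<noteq> 0 \<and> proj_point x \<in> S} \<inter> {x. x \<noteq> 0 \<and> proj_point x \<in> T}" by blast
    then show "open {x. x \<noteq> 0 \<and> proj_point x \<in> S \<inter> T}"
      using S T by (simp add: open_Int)
  next
    fix K :: "(real ^ 'n) set set set"
    assume K: "\<forall>U\<in>K. U \<subseteq> proj_space \<and> open {x. x \<noteq> 0 \<and> proj_point x \<in> U}"
    show "\<Union>K \<subseteq> proj_space" using K by blast
    have "{x. x \<noteq> 0 \<and> proj_point x \<in> \<Union>K} = (\<Union>U\<in>K. {x. x \<noteq> 0 \<and> proj_point x \<in> U})"
      by blast
    then show "open {x. x \<noteq> 0 \<and> proj_point x \<in> \<Union>K}"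
      using K by auto
  qed
  then show ?thesis
    unfolding real_proj_topology_def by (subst topology_inverse') auto
qed

lemma topspace_real_proj_topology:
  "topspace (real_proj_topology :: (real ^ 'n) set topology) = proj_space"
proof -
  have "{x::real ^ 'n. x \<noteq> 0 \<and> proj_point x \<in> proj_space} = - {0}"
    by (auto simp: proj_space_def)
  then have "openin real_proj_topology (proj_space :: (real ^ 'n) set set)"
    by (simp add: openin_real_proj_topology open_Compl)
  moreover have "topspace (real_proj_topology :: (real ^ 'n) set topology) \<subseteq> proj_space"
    using openin_real_proj_topology openin_topspace by blast
  ultimately show ?thesis
    by (simp add: openin_subset subset_antisym)
qed

lemma quotient_map_proj_point:
  "quotient_map (top_of_set (- {0 :: real ^ 'n})) real_proj_topology proj_point"
  unfolding quotient_map_def topspace_real_proj_topology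
proof (intro conjI allI impI)
  show "proj_point ` topspace (top_of_set (- {0 :: real ^ 'n})) = proj_space"
    by (simp add: proj_space_def)
  fix U :: "(real ^ 'n) set set"
  assume U: "U \<subseteq> proj_space"
  have eq: "{x. x \<in> topspace (top_of_set (- {0})) \<and> proj_point x \<in> U}
      = {x. x \<noteq> 0 \<and> proj_point x \<in> U}" by auto
  have "open (- {0 :: real ^ 'n})" by (simp add: open_Compl)
  then show "openin (top_of_set (- {0})) {x \<in> topspace (top_of_set (- {0})). proj_point x \<in> U}
      = openin real_proj_topology U"
    unfolding eq using U
    by (auto simp: openin_real_proj_topology openin_open_eq)
qed


text \<open>The index type \<open>5\<close> (and likewise \<open>4\<close>, \<open>6\<close>) is arithmetic modulo 5, so its elements are
  \<open>1, 2, 3, 4, 5 = 0\<close>. The scalar type \<open>'k\<close> is \<open>real\<close> or \<open>complex\<close>.\<close>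

definition cubic :: "real ^ 6 \<Rightarrow> 'k::real_normed_field ^ 5 \<Rightarrow> 'k" where
  "cubic t x =
     (x$1 ^ 2 + x$2 ^ 2) * x$3 + of_real (t$1) * x$3 ^ 3
     + x$3 ^ 2 * (of_real (t$2) * x$4 + of_real (t$3) * x$5)
     + x$3 * (of_real (t$4) * x$4 ^ 2 + of_real (t$5) * x$5 ^ 2 + of_real (t$6) * x$4 * x$5)
     + x$4 * (x$4 ^ 2 - x$5 ^ 2)"

definition threefold :: "real ^ 6 \<Rightarrow> ('k::real_normed_field ^ 5) set set" where
  "threefold t = proj_point ` {x. x \<noteq> 0 \<and> cubic t x = 0}"

definition singular_locus :: "real ^ 6 \<Rightarrow> ('k::real_normed_field ^ 5) set set" where
  "singular_locus t = proj_point ` {x. x \<noteq> 0 \<and> cubic t x = 0 \<and>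
     (\<forall>i. ((\<lambda>s. cubic t (x + axis i s)) has_field_derivative 0) (at 0))}"


definition holomorphic_fun_on :: "(complex ^ 'n \<Rightarrow> complex) \<Rightarrow> (complex ^ 'n) set \<Rightarrow> bool" where
  "holomorphic_fun_on f U \<longleftrightarrow> open U \<and>
     (\<forall>u\<in>U. \<exists>f'. (f has_derivative f') (at u) \<and> (\<forall>c v. f' (c *s v) = c * f' v))"

definition holomorphic_map_on ::
  "(complex ^ 'n \<Rightarrow> complex ^ 'm) \<Rightarrow> (complex ^ 'n) set \<Rightarrow> bool" where
  "holomorphic_map_on f U \<longleftrightarrow> (\<forall>i. holomorphic_fun_on (\<lambda>u. f u $ i) U)"

text \<open>The germs at \<open>a\<close> of the hypersurface \<open>f = 0\<close> and at \<open>b\<close> of the hypersurface \<open>g = 0\<close> are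
  isomorphic as analytic germs in the ambient affine space: up to the nowhere vanishing
  factor \<open>h\<close>, the biholomorphic map \<open>\<phi>\<close> carries one equation to the other.\<close>

definition locally_analytically_equivalent ::
  "(complex ^ 'n \<Rightarrow> complex) \<Rightarrow> complex ^ 'n \<Rightarrow> (complex ^ 'n \<Rightarrow> complex) \<Rightarrow> complex ^ 'n \<Rightarrow> bool" where
  "locally_analytically_equivalent f a g b \<longleftrightarrow>
     (\<exists>U V \<phi> \<psi> h. a \<in> U \<and> b \<in> V \<and>
        holomorphic_map_on \<phi> U \<and> holomorphic_map_on \<psi> V \<and> \<phi> ` U = V \<and> \<psi> ` V = U \<and>
        (\<forall>u\<in>U. \<psi> (\<phi> u) = u) \<and> (\<forall>v\<in>V. \<phi> (\<psi> v) = v) \<and> \<phi> a = b \<and>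
        holomorphic_fun_on h U \<and> (\<forall>u\<in>U. h u \<noteq> 0 \<and> f u = h u * g (\<phi> u)))"

text \<open>The coordinates are \<open>(x, y, z, w)\<close>.\<close>

definition D4_form :: "complex ^ 4 \<Rightarrow> complex" where
  "D4_form v = v$1 ^ 2 + v$2 ^ 2 + v$3 ^ 2 * v$4 + v$4 ^ 3"

text \<open>The chart \<open>x\<^sub>1 \<noteq> 0\<close>: the affine point \<open>u\<close> is the projective point \<open>[1 : u\<^sub>1 : u\<^sub>2 : u\<^sub>3 : u\<^sub>4]\<close>.\<close>

definition chart1 :: "complex ^ 4 \<Rightarrow> complex ^ 5" where
  "chart1 u = vector [1, u$1, u$2, u$3, u$4]"

definition D4_singularity_at :: "real ^ 6 \<Rightarrow> complex ^ 4 \<Rightarrow> bool" where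
  "D4_singularity_at t a \<longleftrightarrow>
     locally_analytically_equivalent (\<lambda>u. cubic t (chart1 u)) a D4_form 0"


definition D1 :: "real ^ 6 \<Rightarrow> real poly" where
  "D1 t = [: t$1 * t$5 - (t$3) ^ 2 / 4,
             t$2 * t$5 - t$1 - t$3 * t$6 / 2,
             t$4 * t$5 - t$2 - (t$6) ^ 2 / 4,
             t$5 - t$4,
             -1 :]"

definition general_position :: "real ^ 6 \<Rightarrow> bool" where
  "general_position t \<longleftrightarrow>
     (singular_locus t :: (real ^ 5) set set) = {} \<and>
     (singular_locus t :: (complex ^ 5) set set) =
       {proj_point (chart1 (vector [\<i>, 0, 0, 0])), proj_point (chart1 (vector [- \<i>, 0, 0, 0]))} \<and>
     D4_singularity_at t (vector [\<i>, 0, 0, 0]) \<and>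
     D4_singularity_at t (vector [- \<i>, 0, 0, 0]) \<and>
     (\<forall>x. poly (D1 t) x = 0 \<longrightarrow> order x (D1 t) = 1)"

end

theory Submission
  imports Defs "HOL-Real_Asymp.Real_Asymp"
begin

text \<open>In the chart \<open>x\<^sub>3 = 1\<close>, with \<open>u = x\<^sub>4\<close> and \<open>v = x\<^sub>5\<close>, the threefold is \<open>x\<^sub>1\<^sup>2 + x\<^sub>2\<^sup>2 = - g(u, v)\<close>
  with \<open>g = (t\<^sub>5 - u) v\<^sup>2 + 2 B(u) v + C(u)\<close>, and \<open>D\<^sub>1 = (t\<^sub>5 - u) C - B\<^sup>2\<close>. Completing the square,
  \<open>(t\<^sub>5 - u) g = ((t\<^sub>5 - u) v + B)\<^sup>2 + D\<^sub>1(u)\<close>. Hence a singular point with \<open>x\<^sub>3 \<noteq> 0\<close> forces a double root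
  of \<open>D\<^sub>1\<close> or \<open>B(t\<^sub>5) = 0\<close>, so generality means \<open>disc(D\<^sub>1) \<noteq> 0\<close> and \<open>B(t\<^sub>5) \<noteq> 0\<close>.

  Over an interval \<open>I\<close> of the \<open>u\<close>-line with \<open>I < t\<^sub>5\<close> and \<open>D\<^sub>1 \<le> 0\<close> on \<open>I\<close>, the real points form a
  continuous image of \<open>I \<times> S\<^sup>2\<close>, and there are none where \<open>D\<^sub>1 > 0\<close>. Points with \<open>u \<ge> t\<^sub>5\<close> run off to the
  connected part at infinity inside their fibre; the intervals of \<open>{D\<^sub>1 \<le> 0}\<close> that reach \<open>- \<infinity>\<close> or \<open>t\<^sub>5\<close>
  are connected to infinity too. As \<open>D\<^sub>1\<close> is negative at \<open>- \<infinity>\<close> and at \<open>t\<^sub>5\<close>, a further interval exists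
  exactly if all four roots are real and less than \<open>t\<^sub>5\<close>; it gives the single compact component.\<close>

subsection \<open>Singularities\<close>

lemma exhaust_5: "x = 1 \<or> x = 2 \<or> x = 3 \<or> x = 4 \<or> x = 5" for x :: 5
proof (induct x)
  case (of_int z)
  then have "z = 0 \<or> z = 1 \<or> z = 2 \<or> z = 3 \<or> z = 4" by simp arith
  then show ?case by auto
qed

lemma forall_5: "(\<forall>i::5. P i) \<longleftrightarrow> P 1 \<and> P 2 \<and> P 3 \<and> P 4 \<and> P 5"
  by (metis exhaust_5)

lemma vector_5_nth [simp]:
  "(vector [a, b, c, d, e] :: 'a::zero ^ 5) $ 1 = a"
  "(vector [a, b, c, d, e] :: 'a ^ 5) $ 2 = b"
  "(vector [a, b, c, d, e] :: 'a ^ 5) $ 3 = c"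
  "(vector [a, b, c, d, e] :: 'a ^ 5) $ 4 = d"
  "(vector [a, b, c, d, e] :: 'a ^ 5) $ 5 = e"
  unfolding vector_def by simp_all

lemma vector_4_nth [simp]:
  "(vector [a, b, c, d] :: 'a::zero ^ 4) $ 1 = a"
  "(vector [a, b, c, d] :: 'a ^ 4) $ 2 = b"
  "(vector [a, b, c, d] :: 'a ^ 4) $ 3 = c"
  "(vector [a, b, c, d] :: 'a ^ 4) $ 4 = d"
  unfolding vector_def by simp_all

lemma vec5_eq_iff:
  "x = y \<longleftrightarrow> x$1 = y$1 \<and> x$2 = y$2 \<and> x$3 = y$3 \<and> x$4 = y$4 \<and> x$5 = y$5" for x y :: "'a ^ 5"
  by (simp add: vec_eq_iff forall_5)

lemma vec4_eq_iff:
  "x = y \<longleftrightarrow> x$1 = y$1 \<and> x$2 = y$2 \<and> x$3 = y$3 \<and> x$4 = y$4" for x y :: "'a ^ 4"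
  by (simp add: vec_eq_iff forall_4)

lemma proj_point_smult: "c \<noteq> 0 \<Longrightarrow> proj_point (c *s x) = proj_point x"
  by (simp add: proj_point_def vec.span_image_scale[of "{x}" "\<lambda>_. c", simplified])

lemma proj_point_eqD:
  assumes "proj_point x = proj_point y" "x \<noteq> 0"
  obtains c where "c \<noteq> 0" "x = c *s y"
proof -
  have "x \<in> vec.span {y}"
    using assms(1) vec.span_base[of x "{x}"] by (simp add: proj_point_def)
  then obtain c where "x = c *s y"
    by (auto simp: vec.span_singleton)
  moreover have "c \<noteq> 0"
    using calculation assms(2) by auto
  ultimately show thesis using that by blast
qed

section \<open>The discriminant of \<open>D1\<close>\<close>

definition quartic_discriminant :: "'a::comm_ring_1 \<Rightarrow> 'a \<Rightarrow> 'a \<Rightarrow> 'a \<Rightarrow> 'a \<Rightarrow> 'a" where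
  "quartic_discriminant a b c d e =
     256 * a^3 * e^3 - 192 * a^2 * b * d * e^2 - 128 * a^2 * c^2 * e^2 + 144 * a^2 * c * d^2 * e
     - 27 * a^2 * d^4 + 144 * a * b^2 * c * e^2 - 6 * a * b^2 * d^2 * e - 80 * a * b * c^2 * d * e
     + 18 * a * b * c * d^3 + 16 * a * c^4 * e - 4 * a * c^3 * d^2 - 27 * b^4 * e^2
     + 18 * b^3 * c * d * e - 4 * b^3 * d^3 - 4 * b^2 * c^3 * e + b^2 * c^2 * d^2"

text \<open>The two equations are linear in \<open>d\<close> and \<open>e\<close>; solving for these
  leaves a polynomial identity in \<open>a\<close>, \<open>b\<close>, \<open>c\<close>,
  \<open>z\<close>.\<close>

lemma quartic_discriminant_eq_0:
  fixes a b c d e z :: "'a::idom"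
  assumes "a * z^4 + b * z^3 + c * z^2 + d * z + e = 0"
    and "4 * a * z^3 + 3 * b * z^2 + 2 * c * z + d = 0"
  shows "quartic_discriminant a b c d e = 0"
proof -
  have d: "d = - (4 * a * z^3 + 3 * b * z^2 + 2 * c * z)"
    using assms(2) by (simp add: eq_neg_iff_add_eq_0 algebra_simps)
  have e: "e = - (a * z^4 + b * z^3 + c * z^2 + d * z)"
    using assms(1) by (simp add: eq_neg_iff_add_eq_0 algebra_simps)
  have e: "e = 3 * a * z^4 + 2 * b * z^3 + c * z^2"
    unfolding e d by (simp add: algebra_simps power2_eq_square power3_eq_cube power4_eq_xxxx)
  show ?thesis
    unfolding quartic_discriminant_def d e by algebra
qed

definition D1_discriminant :: "real ^ 6 \<Rightarrow> real" where
  "D1_discriminant t = quartic_discriminant (- 1) (t$5 - t$4) (t$4 * t$5 - t$2 - (t$6) ^ 2 / 4)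
     (t$2 * t$5 - t$1 - t$3 * t$6 / 2) (t$1 * t$5 - (t$3) ^ 2 / 4)"

text \<open>The double root may be complex although the discriminant is real; injectivity of
  \<open>of_real\<close> brings the vanishing back to the reals.\<close>

lemma D1_discriminant_eq_0:
  fixes z :: "'k::real_normed_field"
  assumes "- (z^4) + of_real (t$5 - t$4) * z^3 + of_real (t$4 * t$5 - t$2 - (t$6) ^ 2 / 4) * z^2
      + of_real (t$2 * t$5 - t$1 - t$3 * t$6 / 2) * z + of_real (t$1 * t$5 - (t$3) ^ 2 / 4) = 0"
    and "- 4 * z^3 + 3 * of_real (t$5 - t$4) * z^2 + 2 * of_real (t$4 * t$5 - t$2 - (t$6) ^ 2 / 4) * z
      + of_real (t$2 * t$5 - t$1 - t$3 * t$6 / 2) = 0"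
  shows "D1_discriminant t = 0"
proof -
  have "of_real (D1_discriminant t) = (0 :: 'k)"
    using quartic_discriminant_eq_0[of "- 1" z, unfolded mult_minus1 mult_minus1_right, OF assms(1)] assms(2)
    by (simp add: D1_discriminant_def quartic_discriminant_def)
  then show ?thesis by simp
qed

lemma poly_D1:
  "poly (D1 t) z = - (z^4) + (t$5 - t$4) * z^3 + (t$4 * t$5 - t$2 - (t$6) ^ 2 / 4) * z^2
      + (t$2 * t$5 - t$1 - t$3 * t$6 / 2) * z + (t$1 * t$5 - (t$3) ^ 2 / 4)"
  by (simp add: D1_def algebra_simps power2_eq_square power3_eq_cube power4_eq_xxxx)

lemma poly_pderiv_D1:
  "poly (pderiv (D1 t)) z = - 4 * z^3 + 3 * (t$5 - t$4) * z^2
      + 2 * (t$4 * t$5 - t$2 - (t$6) ^ 2 / 4) * z + (t$2 * t$5 - t$1 - t$3 * t$6 / 2)"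
  by (simp add: D1_def pderiv_pCons algebra_simps power2_eq_square power3_eq_cube)

lemma D1_simple_roots:
  assumes "D1_discriminant t \<noteq> 0" "poly (D1 t) x = 0"
  shows "poly (pderiv (D1 t)) x \<noteq> 0"
  using assms D1_discriminant_eq_0[of x t] by (auto simp: poly_D1 poly_pderiv_D1)

lemma degree_D1: "degree (D1 t) = 4"
  by (simp add: D1_def)

lemma D1_nz: "D1 t \<noteq> 0"
  by (simp add: D1_def)

lemma order_D1:
  assumes "D1_discriminant t \<noteq> 0" "poly (D1 t) x = 0"
  shows "order x (D1 t) = 1"
proof -
  have "pderiv (D1 t) \<noteq> 0"
    using D1_simple_roots[OF assms] by auto
  have "order x (D1 t) \<noteq> 0"
    using assms(2) D1_nz by (simp add: order_root)
  then have "order x (D1 t) = Suc (order x (pderiv (D1 t)))"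
    using order_pderiv[OF D1_nz assms(2)] by simp
  then show ?thesis using D1_simple_roots[OF assms] by (simp add: order_0I)
qed

section \<open>Gradient and singular locus\<close>

definition cubic_grad :: "real ^ 6 \<Rightarrow> 'k::real_normed_field ^ 5 \<Rightarrow> 'k ^ 5" where
  "cubic_grad t x = vector
     [2 * x$1 * x$3, 2 * x$2 * x$3,
      x$1 ^ 2 + x$2 ^ 2 + 3 * of_real (t$1) * x$3 ^ 2
        + 2 * x$3 * (of_real (t$2) * x$4 + of_real (t$3) * x$5)
        + (of_real (t$4) * x$4 ^ 2 + of_real (t$5) * x$5 ^ 2 + of_real (t$6) * x$4 * x$5),
      of_real (t$2) * x$3 ^ 2 + x$3 * (2 * of_real (t$4) * x$4 + of_real (t$6) * x$5)
        + 3 * x$4 ^ 2 - x$5 ^ 2,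
      of_real (t$3) * x$3 ^ 2 + x$3 * (2 * of_real (t$5) * x$5 + of_real (t$6) * x$4)
        - 2 * x$4 * x$5]"

lemma cubic_has_field_derivative:
  fixes x :: "'k::real_normed_field ^ 5"
  shows "((\<lambda>s. cubic t (x + axis i s)) has_field_derivative cubic_grad t x $ i) (at 0)"
proof -
  have "i = 1 \<or> i = 2 \<or> i = 3 \<or> i = 4 \<or> i = 5" by (rule exhaust_5)
  then show ?thesis
    by (elim disjE; hypsubst; unfold cubic_def axis_def cubic_grad_def; simp;
        auto intro!: derivative_eq_intros simp: algebra_simps power2_eq_square)
qed

lemma singular_locus_eq:
  "singular_locus t = proj_point ` {x :: 'k::real_normed_field ^ 5. x \<noteq> 0 \<and> cubic t x = 0 \<and> cubic_grad t x = 0}"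
proof -
  have "(\<forall>i. ((\<lambda>s. cubic t (x + axis i s)) has_field_derivative 0) (at 0)) \<longleftrightarrow>
        cubic_grad t x = 0" for x :: "'k::real_normed_field ^ 5"
    by (auto simp: vec_eq_iff intro: DERIV_unique[OF cubic_has_field_derivative])
       (metis cubic_has_field_derivative)
  then show ?thesis by (simp add: singular_locus_def)
qed

text \<open>For \<open>x$3 \<noteq> 0\<close> the first two partials kill \<open>x$1\<close> and
  \<open>x$2\<close>, so \<open>(u, v)\<close> is a singular point of \<open>g = 0\<close> and
  \<open>u\<close> is a double root of \<open>D1\<close>. For \<open>x$3 = 0\<close> the last two
  partials force \<open>x$4 = x$5 = 0\<close>, and the third gives the remaining equation.\<close>

lemma cubic_singular_imp:
  fixes x :: "'k::real_normed_field ^ 5"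
  assumes gen: "t$6 * t$5 + t$3 \<noteq> 0" "D1_discriminant t \<noteq> 0"
    and sing: "cubic t x = 0" "cubic_grad t x = 0"
  shows "x$3 = 0 \<and> x$4 = 0 \<and> x$5 = 0 \<and> x$1 ^ 2 + x$2 ^ 2 = 0"
proof -
  have x3: "x$3 = 0"
  proof (rule ccontr)
    assume nz: "x$3 \<noteq> 0"
    define u v where "u = x$4 / x$3" and "v = x$5 / x$3"
    have xs: "x$4 = u * x$3" "x$5 = v * x$3"
      using nz by (auto simp: u_def v_def)
    have x12: "x$1 = 0" "x$2 = 0"
      using sing(2) nz by (auto simp: vec5_eq_iff cubic_grad_def)
    define B :: 'k where "B = (of_real (t$6) * u + of_real (t$3)) / 2"
    have "x$3 ^ 3 * (u^3 - u * v^2 + of_real (t$4) * u^2 + of_real (t$5) * v^2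
        + of_real (t$6) * u * v + of_real (t$2) * u + of_real (t$3) * v + of_real (t$1)) = 0"
      using sing(1) unfolding cubic_def xs x12
      by (simp add: algebra_simps power2_eq_square power3_eq_cube)
    then have g: "u^3 - u * v^2 + of_real (t$4) * u^2 + of_real (t$5) * v^2
        + of_real (t$6) * u * v + of_real (t$2) * u + of_real (t$3) * v + of_real (t$1) = 0"
      using nz by simp
    have "x$3 ^ 2 * (3 * u^2 - v^2 + 2 * of_real (t$4) * u + of_real (t$6) * v + of_real (t$2)) = 0"
      using sing(2) unfolding cubic_grad_def vec5_eq_iff xs x12
      by (simp add: algebra_simps power2_eq_square)
    then have gu: "3 * u^2 - v^2 + 2 * of_real (t$4) * u + of_real (t$6) * v + of_real (t$2) = 0"
      using nz by simp
    have "x$3 ^ 2 * (- 2 * u * v + 2 * of_real (t$5) * v + of_real (t$6) * u + of_real (t$3)) = 0"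
      using sing(2) unfolding cubic_grad_def vec5_eq_iff xs x12
      by (simp add: algebra_simps power2_eq_square)
    then have gv: "- 2 * u * v + 2 * of_real (t$5) * v + of_real (t$6) * u + of_real (t$3) = 0"
      using nz by simp
    have "D1_discriminant t = 0"
    proof (rule D1_discriminant_eq_0[of u])
      \<comment> \<open>Four times the completed square: with
        \<open>g_v = 2 ((t5 - u) v + B)\<close> it reads
        \<open>4 D1 = 4 (t5 - u) g - g_v^2\<close>.\<close>
      have "4 * (- (u^4) + of_real (t$5 - t$4) * u^3 + of_real (t$4 * t$5 - t$2 - (t$6) ^ 2 / 4) * u^2
      + of_real (t$2 * t$5 - t$1 - t$3 * t$6 / 2) * u + of_real (t$1 * t$5 - (t$3) ^ 2 / 4))
       = 4 * (of_real (t$5) - u) * (u^3 - u * v^2 + of_real (t$4) * u^2 + of_real (t$5) * v^2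
        + of_real (t$6) * u * v + of_real (t$2) * u + of_real (t$3) * v + of_real (t$1))
        - (- 2 * u * v + 2 * of_real (t$5) * v + of_real (t$6) * u + of_real (t$3))^2"
        by (simp add: field_simps power2_eq_square power3_eq_cube power4_eq_xxxx)
      then show "- (u^4) + of_real (t$5 - t$4) * u^3 + of_real (t$4 * t$5 - t$2 - (t$6) ^ 2 / 4) * u^2
      + of_real (t$2 * t$5 - t$1 - t$3 * t$6 / 2) * u + of_real (t$1 * t$5 - (t$3) ^ 2 / 4) = 0"
        unfolding g gv by (metis mult_eq_0_iff mult_zero_right diff_self power_zero_numeral zero_neq_numeral)
      \<comment> \<open>Half the \<open>u\<close>-derivative of the previous identity, with
        \<open>g_uv = t6 - 2 v\<close>.\<close>
      have "2 * (- 4 * u^3 + 3 * of_real (t$5 - t$4) * u^2 + 2 * of_real (t$4 * t$5 - t$2 - (t$6) ^ 2 / 4) * u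
      + of_real (t$2 * t$5 - t$1 - t$3 * t$6 / 2))
       = 2 * (of_real (t$5) - u) * (3 * u^2 - v^2 + 2 * of_real (t$4) * u + of_real (t$6) * v + of_real (t$2))
         - 2 * (u^3 - u * v^2 + of_real (t$4) * u^2 + of_real (t$5) * v^2
        + of_real (t$6) * u * v + of_real (t$2) * u + of_real (t$3) * v + of_real (t$1))
        - (- 2 * u * v + 2 * of_real (t$5) * v + of_real (t$6) * u + of_real (t$3)) * (of_real (t$6) - 2 * v)"
        by (simp add: field_simps power2_eq_square power3_eq_cube power4_eq_xxxx)
      then show "- 4 * u^3 + 3 * of_real (t$5 - t$4) * u^2 + 2 * of_real (t$4 * t$5 - t$2 - (t$6) ^ 2 / 4) * u
      + of_real (t$2 * t$5 - t$1 - t$3 * t$6 / 2) = 0"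
        unfolding g gu gv by (metis mult_eq_0_iff mult_zero_right mult_zero_left diff_self zero_neq_numeral)
    qed
    then show False using gen(2) by simp
  qed
  show ?thesis
    using sing(2) x3 by (auto simp: vec5_eq_iff cubic_grad_def)
qed

lemma real_singular_locus:
  assumes "t$6 * t$5 + t$3 \<noteq> 0" "D1_discriminant t \<noteq> 0"
  shows "(singular_locus t :: (real ^ 5) set set) = {}"
proof -
  have False if "x \<noteq> 0" "cubic t x = 0" "cubic_grad t x = 0" for x :: "real ^ 5"
    using cubic_singular_imp[OF assms that(2,3)] that(1)
    by (auto simp: vec5_eq_iff sum_power2_eq_zero_iff)
  then show ?thesis unfolding singular_locus_eq by blast
qed

lemma complex_singular_locus:
  assumes "t$6 * t$5 + t$3 \<noteq> 0" "D1_discriminant t \<noteq> 0"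
  shows "(singular_locus t :: (complex ^ 5) set set) =
    {proj_point (chart1 (vector [\<i>, 0, 0, 0])), proj_point (chart1 (vector [- \<i>, 0, 0, 0]))}"
proof -
  let ?p = "\<lambda>z. chart1 (vector [z, 0, 0, 0])"
  have sing: "?p z \<noteq> 0 \<and> cubic t (?p z) = 0 \<and> cubic_grad t (?p z) = 0" if "z\<^sup>2 = -1" for z
    using that by (auto simp: vec5_eq_iff chart1_def cubic_def cubic_grad_def)
  have "proj_point x \<in> {proj_point (?p \<i>), proj_point (?p (- \<i>))}"
    if x: "x \<noteq> 0" "cubic t x = 0" "cubic_grad t x = 0" for x :: "complex ^ 5"
  proof -
    note 0 = cubic_singular_imp[OF assms x(2,3)]
    have nz: "x$1 \<noteq> 0" using 0 x(1) by (auto simp: vec5_eq_iff)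
    have "(x$2 - \<i> * x$1) * (x$2 + \<i> * x$1) = 0"
      using 0 by (simp add: algebra_simps power2_eq_square)
    then have "x$2 = \<i> * x$1 \<or> x$2 = - \<i> * x$1"
      by (auto simp: add_eq_0_iff)
    then have "x = x$1 *s ?p \<i> \<or> x = x$1 *s ?p (- \<i>)"
      using 0 by (auto simp: vec5_eq_iff chart1_def)
    then show ?thesis
      by (metis insert_iff nz proj_point_smult)
  qed
  moreover have "proj_point (?p z) \<in> singular_locus t" if "z\<^sup>2 = -1" for z
    unfolding singular_locus_eq using sing[OF that] by blast
  ultimately show ?thesis
    unfolding singular_locus_eq by auto
qed

section \<open>Holomorphic functions and the normal form of the singularities\<close>

lemma holomorphic_fun_on_component: "open U \<Longrightarrow> holomorphic_fun_on (\<lambda>u. u $ i) U"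
  unfolding holomorphic_fun_on_def
  by (auto intro!: exI[of _ "\<lambda>v. v $ i"] bounded_linear_imp_has_derivative bounded_linear_vec_nth)

lemma holomorphic_fun_on_const: "open U \<Longrightarrow> holomorphic_fun_on (\<lambda>u. c) U"
  unfolding holomorphic_fun_on_def by (auto intro!: exI[of _ "\<lambda>v. 0"])

lemma holomorphic_fun_on_add:
  assumes "holomorphic_fun_on f U" "holomorphic_fun_on g U"
  shows "holomorphic_fun_on (\<lambda>u. f u + g u) U"
  unfolding holomorphic_fun_on_def
proof (intro conjI ballI)
  show "open U" using assms(1) by (simp add: holomorphic_fun_on_def)
  fix u assume "u \<in> U"
  then obtain f' g' where "(f has_derivative f') (at u)" "\<And>c v. f' (c *s v) = c * f' v"
    "(g has_derivative g') (at u)" "\<And>c v. g' (c *s v) = c * g' v"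
    using assms unfolding holomorphic_fun_on_def by metis
  then show "\<exists>h. ((\<lambda>u. f u + g u) has_derivative h) (at u) \<and> (\<forall>c v. h (c *s v) = c * h v)"
    by (intro exI[of _ "\<lambda>v. f' v + g' v"]) (auto intro: has_derivative_add simp: algebra_simps)
qed

lemma holomorphic_fun_on_mult:
  assumes "holomorphic_fun_on f U" "holomorphic_fun_on g U"
  shows "holomorphic_fun_on (\<lambda>u. f u * g u) U"
  unfolding holomorphic_fun_on_def
proof (intro conjI ballI)
  show "open U" using assms(1) by (simp add: holomorphic_fun_on_def)
  fix u assume "u \<in> U"
  then obtain f' g' where "(f has_derivative f') (at u)" "\<And>c v. f' (c *s v) = c * f' v"
    "(g has_derivative g') (at u)" "\<And>c v. g' (c *s v) = c * g' v"
    using assms unfolding holomorphic_fun_on_def by metis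
  then show "\<exists>h. ((\<lambda>u. f u * g u) has_derivative h) (at u) \<and> (\<forall>c v. h (c *s v) = c * h v)"
    by (intro exI[of _ "\<lambda>v. f u * g' v + f' v * g u"])
       (auto intro: has_derivative_mult simp: algebra_simps)
qed

lemma holomorphic_fun_on_compose:
  assumes "holomorphic_fun_on f U" "\<And>u. u \<in> U \<Longrightarrow> F field_differentiable at (f u)"
  shows "holomorphic_fun_on (\<lambda>u. F (f u)) U"
  unfolding holomorphic_fun_on_def
proof (intro conjI ballI)
  show "open U" using assms(1) by (simp add: holomorphic_fun_on_def)
  fix u assume u: "u \<in> U"
  then obtain f' where f': "(f has_derivative f') (at u)" "\<And>c v. f' (c *s v) = c * f' v"
    using assms(1) unfolding holomorphic_fun_on_def by metis
  obtain D where "(F has_derivative (*) D) (at (f u))"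
    using assms(2)[OF u] by (auto simp: field_differentiable_def has_field_derivative_def)
  from has_derivative_compose[OF f'(1) this]
  show "\<exists>h. ((\<lambda>u. F (f u)) has_derivative h) (at u) \<and> (\<forall>c v. h (c *s v) = c * h v)"
    by (intro exI[of _ "\<lambda>v. D * f' v"]) (auto simp: f'(2))
qed

lemma holomorphic_fun_on_power:
  "holomorphic_fun_on f U \<Longrightarrow> holomorphic_fun_on (\<lambda>u. f u ^ n) U"
  by (rule holomorphic_fun_on_compose) (auto intro!: derivative_intros simp: field_differentiable_def)

lemmas holomorphic_fun_on_intros =
  holomorphic_fun_on_component holomorphic_fun_on_const holomorphic_fun_on_add
  holomorphic_fun_on_mult holomorphic_fun_on_power

text \<open>A purely imaginary root would have its square on the branch cut.\<close>

lemma Re_csqrt_pos: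
  assumes "z \<notin> \<real>\<^sub>\<le>\<^sub>0"
  shows "0 < Re (csqrt z)"
proof (rule ccontr)
  assume "\<not> 0 < Re (csqrt z)"
  then have "Re (csqrt z) = 0" using Re_csqrt[of z] by linarith
  then have "Re ((csqrt z)\<^sup>2) \<le> 0 \<and> Im ((csqrt z)\<^sup>2) = 0"
    by (simp add: power2_eq_square)
  then show False using assms by (simp add: complex_nonpos_Reals_iff)
qed

text \<open>With \<open>Y = 1 + x\<^sub>2\<^sup>2 + Q(x\<^sub>3, x\<^sub>4, x\<^sub>5)\<close> the equation reads \<open>Y x\<^sub>3 + x\<^sub>4\<^sup>3 - x\<^sub>4 x\<^sub>5\<^sup>2\<close>, which
  is the \<open>D\<^sub>4\<close> form in the coordinates \<open>(Y + x\<^sub>3)/2\<close>, \<open>(Y - x\<^sub>3)/2\<i>\<close>, \<open>\<i> x\<^sub>5\<close>, \<open>x\<^sub>4\<close>.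
  On the half plane \<open>Im (\<sigma> x\<^sub>2) > 0\<close> the coordinate \<open>x\<^sub>2\<close> is recovered from \<open>Y\<close> by a square root.\<close>

definition chart_quadric :: "real ^ 6 \<Rightarrow> complex \<Rightarrow> complex \<Rightarrow> complex \<Rightarrow> complex" where
  "chart_quadric t a b c = of_real (t$1) * a^2 + a * (of_real (t$2) * b + of_real (t$3) * c)
     + of_real (t$4) * b^2 + of_real (t$5) * c^2 + of_real (t$6) * (b * c)"

lemma D4_singularity_chart1:
  assumes \<sigma>: "\<sigma> = 1 \<or> \<sigma> = (-1 :: complex)"
  shows "D4_singularity_at t (vector [\<sigma> * \<i>, 0, 0, 0])"
proof -
  define U :: "(complex ^ 4) set" where "U = {u. 0 < Im (\<sigma> * u$1)}"
  \<comment> \<open>\<open>rad v\<close> is \<open>- x_2 ^ 2\<close> in the target coordinates,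
    where \<open>v$1 + \<i> * v$2\<close> is \<open>Y\<close> and \<open>v$1 - \<i> * v$2\<close> is
    \<open>x_3\<close>. Differences are written as sums to match
    \<open>holomorphic_fun_on_intros\<close>.\<close>
  define rad :: "complex ^ 4 \<Rightarrow> complex" where
    "rad v = 1 + chart_quadric t (v$1 + - \<i> * v$2) (v$4) (- \<i> * v$3) + - 1 * (v$1 + \<i> * v$2)" for v
  define V where "V = {v. rad v \<notin> \<real>\<^sub>\<le>\<^sub>0}"
  define Y :: "complex ^ 4 \<Rightarrow> complex" where
    "Y u = 1 + u$1 ^ 2 + chart_quadric t (u$2) (u$3) (u$4)" for u
  define \<phi> :: "complex ^ 4 \<Rightarrow> complex ^ 4" where
    "\<phi> u = vector [(1/2) * (Y u + u$2), (- \<i> / 2) * (Y u + - 1 * u$2), \<i> * u$4, u$3]" for u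
  define \<psi> :: "complex ^ 4 \<Rightarrow> complex ^ 4" where
    "\<psi> v = vector [\<sigma> * \<i> * csqrt (rad v), v$1 + - \<i> * v$2, v$4, - \<i> * v$3]" for v
  have \<sigma>2: "\<sigma> * \<sigma> = 1" using \<sigma> by auto
  have rad_hol: "holomorphic_fun_on rad W" if "open W" for W
    unfolding rad_def chart_quadric_def by (intro holomorphic_fun_on_intros that)
  have "continuous_on UNIV rad"
    unfolding rad_def chart_quadric_def by (intro continuous_intros)
  then have "open V"
    unfolding V_def using open_vimage[of "- \<real>\<^sub>\<le>\<^sub>0" rad]
    by (simp add: vimage_def closed_nonpos_Reals_complex open_Compl)
  have "open U"
    unfolding U_def by (intro open_Collect_less continuous_intros)
  \<comment> \<open>On \<open>U\<close> the base of this square has positive real part, so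
    \<open>rad (\<phi> u)\<close> avoids the branch cut and \<open>csqrt\<close> returns the
    base.\<close>
  have rad_\<phi>: "rad (\<phi> u) = (- \<i> * (\<sigma> * u$1)) ^ 2" for u
  proof -
    have 1: "\<phi> u $ 1 + - \<i> * \<phi> u $ 2 = u$2" "\<phi> u $ 1 + \<i> * \<phi> u $ 2 = Y u"
      by (simp_all add: \<phi>_def field_simps)
    have 2: "- \<i> * \<phi> u $ 3 = u$4" "\<phi> u $ 4 = u$3" by (simp_all add: \<phi>_def)
    show ?thesis unfolding rad_def 1 2
      using \<sigma> by (auto simp: Y_def power_mult_distrib)
  qed
  have \<phi>_V: "\<phi> u \<in> V" if "u \<in> U" for u
  proof -
    have "0 < Re (- \<i> * (\<sigma> * u$1))" using that by (simp add: U_def)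
    moreover have sq: "z^2 \<notin> \<real>\<^sub>\<le>\<^sub>0" if "0 < Re z" for z :: complex
      using that by (auto simp: complex_nonpos_Reals_iff power2_eq_square not_le)
    ultimately have "rad (\<phi> u) \<notin> \<real>\<^sub>\<le>\<^sub>0" unfolding rad_\<phi> by (intro sq)
    then show ?thesis by (simp add: V_def)
  qed
  have \<psi>\<phi>: "\<psi> (\<phi> u) = u" if "u \<in> U" for u
  proof -
    have "0 < Re (- \<i> * (\<sigma> * u$1))" using that by (simp add: U_def)
    then have "csqrt (rad (\<phi> u)) = - \<i> * (\<sigma> * u$1)"
      unfolding rad_\<phi> by (intro csqrt_square) auto
    then show ?thesis
      using \<sigma>2 by (simp add: vec4_eq_iff \<psi>_def) (simp add: \<phi>_def field_simps)
  qed
  have \<psi>_U: "\<psi> v \<in> U" if "v \<in> V" for v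
  proof -
    have "0 < Re (csqrt (rad v))"
      using that by (intro Re_csqrt_pos) (simp add: V_def)
    moreover have "Im (\<sigma> * \<psi> v $ 1) = Re (csqrt (rad v))"
      using \<sigma> by (auto simp: \<psi>_def)
    ultimately show ?thesis unfolding U_def mem_Collect_eq by metis
  qed
  have \<phi>\<psi>: "\<phi> (\<psi> v) = v" for v
  proof -
    have "(\<psi> v $ 1)^2 = - rad v" using \<sigma> by (auto simp: \<psi>_def power_mult_distrib)
    then have "Y (\<psi> v) = v$1 + \<i> * v$2"
      unfolding Y_def by (simp add: rad_def \<psi>_def)
    then show ?thesis
      by (simp add: vec4_eq_iff \<phi>_def) (simp add: \<psi>_def field_simps)
  qed
  \<comment> \<open>The equations agree exactly, so the unit \<open>h\<close> can be 1: the first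
    two squares sum to \<open>Y * x_3\<close>, and the factor \<open>\<i>\<close> on
    \<open>x_5\<close> flips the sign of its square.\<close>
  have eq: "cubic t (chart1 u) = D4_form (\<phi> u)" for u
  proof -
    have "\<phi> u $ 1 ^ 2 + \<phi> u $ 2 ^ 2 = Y u * u$2"
      by (simp add: \<phi>_def power_mult_distrib power2_eq_square algebra_simps)
    then show ?thesis
      unfolding D4_form_def by (simp add: \<phi>_def cubic_def chart1_def Y_def chart_quadric_def algebra_simps
         power2_eq_square power3_eq_cube)
  qed
  have "holomorphic_map_on \<phi> U"
    unfolding holomorphic_map_on_def forall_4 \<phi>_def vector_4_nth Y_def chart_quadric_def
    by (intro conjI holomorphic_fun_on_intros \<open>open U\<close>)
  moreover have "holomorphic_fun_on (\<lambda>v. csqrt (rad v)) V"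
    by (rule holomorphic_fun_on_compose[OF rad_hol[OF \<open>open V\<close>]])
       (auto simp: V_def intro: field_differentiable_at_csqrt)
  then have "holomorphic_map_on \<psi> V"
    unfolding holomorphic_map_on_def forall_4 \<psi>_def vector_4_nth
    by (intro conjI holomorphic_fun_on_intros \<open>open V\<close>)
  moreover have "\<phi> ` U = V"
    using \<phi>_V \<psi>_U \<phi>\<psi> by (metis image_subsetI subset_antisym subsetI image_eqI)
  moreover have "\<psi> ` V = U"
    using \<phi>_V \<psi>_U \<psi>\<phi> by (metis image_subsetI subset_antisym subsetI image_eqI)
  moreover have "vector [\<sigma> * \<i>, 0, 0, 0] \<in> U"
    using \<sigma> by (auto simp: U_def)
  moreover have a: "\<phi> (vector [\<sigma> * \<i>, 0, 0, 0]) = 0"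
    using \<sigma> by (auto simp: \<phi>_def Y_def chart_quadric_def vec4_eq_iff)
  moreover have "0 \<in> V"
    using \<phi>_V[of "vector [\<sigma> * \<i>, 0, 0, 0]"] calculation by metis
  ultimately show ?thesis
    unfolding D4_singularity_at_def locally_analytically_equivalent_def
    by (intro exI[of _ U] exI[of _ V] exI[of _ \<phi>] exI[of _ \<psi>] exI[of _ "\<lambda>_. 1"] conjI)
       (auto simp: eq \<psi>\<phi> \<phi>\<psi> \<open>open U\<close> intro: holomorphic_fun_on_const)
qed

section \<open>The exceptional hypersurface in parameter space\<close>

lemma general_positionI:
  assumes "t$6 * t$5 + t$3 \<noteq> 0" "D1_discriminant t \<noteq> 0"
  shows "general_position t"
  unfolding general_position_def
  using real_singular_locus[OF assms] complex_singular_locus[OF assms]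
    D4_singularity_chart1[of 1 t] D4_singularity_chart1[of "-1" t] order_D1[OF assms(2)]
  by simp

text \<open>The first factor vanishes exactly when \<open>t$5\<close> is a root of
  \<open>D1 t\<close>.\<close>

definition exceptional :: "real ^ 6 \<Rightarrow> real" where
  "exceptional t = (t$6 * t$5 + t$3) * D1_discriminant t"

lemma exceptional_polynomial: "real_polynomial_function exceptional"
proof -
  have coord: "real_polynomial_function (\<lambda>t :: real ^ 6. t $ i)" for i
    by (intro real_polynomial_function.intros(1) bounded_linear_vec_nth)
  then show ?thesis
    unfolding exceptional_def D1_discriminant_def quartic_discriminant_def divide_inverse
    by (intro coord real_polynomial_function_power real_polynomial_function_diff
        real_polynomial_function_minus real_polynomial_function.intros(2,3,4))
qed

lemma exceptional_nonzero: "\<exists>t. exceptional t \<noteq> 0"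
proof -
  \<comment> \<open>Here \<open>D1 t\<close> is \<open>- x^4 - 1\<close>, of discriminant 256, and
    the first factor is 2.\<close>
  have "exceptional (axis 3 2) \<noteq> 0"
    by (simp add: exceptional_def D1_discriminant_def quartic_discriminant_def axis_def)
  then show ?thesis ..
qed

subsection \<open>Paths on the affine cone\<close>

text \<open>Paths are explicit vectors in this punctured cone; \<open>proj_point\<close> carries
  connected sets down to the threefold.\<close>

definition cone :: "real ^ 6 \<Rightarrow> (real ^ 5) set" where
  "cone t = {x. x \<noteq> 0 \<and> cubic t x = 0}"

lemma cubic_smult: "cubic t (c *s x) = c ^ 3 * cubic t x"
  by (simp add: cubic_def algebra_simps power2_eq_square power3_eq_cube)

lemma cone_smult: "x \<in> cone t \<Longrightarrow> c \<noteq> 0 \<Longrightarrow> c *s x \<in> cone t"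
  by (auto simp: cone_def cubic_smult vec_eq_iff)

lemma continuous_on_vector_5 [continuous_intros]:
  fixes a b c d e :: "'b::topological_space \<Rightarrow> 'a::{topological_space, zero}"
  assumes "continuous_on S a" "continuous_on S b" "continuous_on S c" "continuous_on S d"
    "continuous_on S e"
  shows "continuous_on S (\<lambda>x. vector [a x, b x, c x, d x, e x] :: 'a ^ 5)"
proof -
  have "continuous_on S (\<lambda>x. \<chi> i::5. (vector [a x, b x, c x, d x, e x] :: 'a ^ 5) $ i)"
  proof (rule continuous_on_vec_lambda)
    fix i :: 5
    show "continuous_on S (\<lambda>x. (vector [a x, b x, c x, d x, e x] :: 'a ^ 5) $ i)"
      using exhaust_5[of i] assms by auto
  qed
  then show ?thesis by simp
qed

lemma connected_componentI_image:
  assumes "connected I" "continuous_on I f" "f ` I \<subseteq> S" "a \<in> I" "b \<in> I"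
  shows "connected_component S (f a) (f b)"
  using assms connected_continuous_image unfolding connected_component_def by blast

lemma connected_component_cone_smult:
  assumes "x \<in> cone t" "0 < c"
  shows "connected_component (cone t) x (c *s x)"
proof -
  have "connected_component (cone t) ((\<lambda>s. s *s x) 1) ((\<lambda>s. s *s x) c)"
    using assms
    by (intro connected_componentI_image[where I = "{0<..}"])
       (auto simp: scalar_mult_eq_scaleR cone_smult[unfolded scalar_mult_eq_scaleR] intro!: continuous_intros)
  then show ?thesis by simp
qed

text \<open>At infinity \<open>X\<close> consists of three planes through a common line.\<close>

lemma connected_component_infinity_axis:
  assumes x: "x \<in> cone t" "x$3 = 0" and j: "j = 1 \<or> j = 2" and i: "i \<noteq> j" "x$i \<noteq> 0"
  shows "connected_component (cone t) x (axis j 1)"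
proof -
  \<comment> \<open>On \<open>x$3 = 0\<close> the equation involves only \<open>x$4\<close> and
    \<open>x$5\<close>, which the segment merely scales by \<open>1 - s\<close>. Coordinate
    \<open>i\<close> keeps the vector nonzero until \<open>s = 1\<close>.\<close>
  let ?f = "\<lambda>s. (1 - s) *\<^sub>R x + s *\<^sub>R axis j 1"
  have "?f s \<in> cone t" if "s \<in> {0..1}" for s
  proof -
    have "?f s \<noteq> 0"
    proof (cases "s = 1")
      case True
      then show ?thesis by (simp add: axis_eq_0_iff)
    next
      case False
      then have "?f s $ i \<noteq> 0" using i by (simp add: axis_def)
      then show ?thesis by (metis zero_index)
    qed
    moreover have "x$4 * (x$4 ^ 2 - x$5 ^ 2) = 0"
      using x by (simp add: cone_def cubic_def)
    then have "(1 - s) ^ 3 * (x$4 * (x$4 ^ 2 - x$5 ^ 2)) = 0" by simp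
    then have "cubic t (?f s) = 0"
      using x(2) j by (auto simp: cubic_def axis_def algebra_simps power2_eq_square power3_eq_cube)
    ultimately show ?thesis by (simp add: cone_def)
  qed
  then have "connected_component (cone t) (?f 0) (?f 1)"
    by (intro connected_componentI_image[where I = "{0..1}"] continuous_intros) auto
  then show ?thesis by simp
qed

text \<open>From a negative multiple of \<open>axis 1 1\<close> the segment to
  \<open>axis 1 1\<close> would cross the origin, so multiples of \<open>axis 1 1\<close> go by way
  of \<open>axis 2 1\<close>.\<close>

lemma connected_component_infinity:
  assumes x: "x \<in> cone t" "x$3 = 0"
  shows "connected_component (cone t) x (axis 1 1)"
proof (cases "\<exists>i. i \<noteq> 1 \<and> x$i \<noteq> 0")
  case True
  then show ?thesis using connected_component_infinity_axis[OF x, of 1] by blast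
next
  case False
  then have "x$i = 0" if "i \<noteq> 1" for i using that by blast
  from this[of 2] this[of 4] this[of 5] have "x$1 \<noteq> 0"
    using x by (auto simp: cone_def vec5_eq_iff)
  then have "connected_component (cone t) x (axis 2 1)"
    by (intro connected_component_infinity_axis[OF x, of 2 1]) auto
  moreover have "connected_component (cone t) (axis 2 1) (axis 1 1)"
    by (rule connected_component_infinity_axis[where i = 2])
       (auto simp: cone_def cubic_def axis_eq_0_iff, auto simp: axis_def)
  ultimately show ?thesis by (rule connected_component_trans)
qed

section \<open>Fibres as spheres\<close>

definition slope :: "real ^ 6 \<Rightarrow> real \<Rightarrow> real" where
  "slope t u = (t$6 * u + t$3) / 2"

text \<open>In the coordinates \<open>x\<^sub>1 \<surd>(t\<^sub>5 - u)\<close>, \<open>x\<^sub>2 \<surd>(t\<^sub>5 - u)\<close>, \<open>(t\<^sub>5 - u) v + B\<close> the fibre of \<open>X\<close> over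
  \<open>u = x\<^sub>4 < t\<^sub>5\<close> is the sphere of radius \<open>\<surd>(- D\<^sub>1(u))\<close>; \<open>B\<close> is \<open>slope t u\<close>.\<close>

lemma cubic_complete_square:
  assumes "x$3 = 1"
  shows "(t$5 - x$4) * cubic t x =
    (t$5 - x$4) * (x$1 ^ 2 + x$2 ^ 2) + ((t$5 - x$4) * x$5 + slope t (x$4)) ^ 2 + poly (D1 t) (x$4)"
  unfolding cubic_def poly_D1 slope_def assms
  by (simp add: field_simps power2_eq_square power3_eq_cube power4_eq_xxxx)

definition slab :: "real ^ 6 \<Rightarrow> real set \<Rightarrow> (real ^ 5) set" where
  "slab t I = {x \<in> cone t. x$3 = 1 \<and> x$4 \<in> I}"

text \<open>Completing the square expresses \<open>- poly (D1 t) (x$4)\<close> as a sum of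
  nonnegative terms.\<close>

lemma D1_slab:
  assumes "x \<in> cone t" "x$3 = 1" "x$4 \<le> t$5"
  shows "poly (D1 t) (x$4) \<le> 0"
proof -
  have "0 \<le> (t$5 - x$4) * (x$1 ^ 2 + x$2 ^ 2) + ((t$5 - x$4) * x$5 + slope t (x$4)) ^ 2"
    using assms by simp
  then show ?thesis
    using cubic_complete_square[OF assms(2), of t] assms(1) by (simp add: cone_def)
qed

text \<open>Scaling the unit sphere by the radius keeps the map continuous at roots of
  \<open>D1 t\<close>, where the fibre shrinks to a point.\<close>

definition slab_map :: "real ^ 6 \<Rightarrow> real \<times> (real ^ 3) \<Rightarrow> real ^ 5" where
  "slab_map t = (\<lambda>(u, s). vector
     [sqrt (- poly (D1 t) u) * s$1 / sqrt (t$5 - u), sqrt (- poly (D1 t) u) * s$2 / sqrt (t$5 - u),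
      1, u, (sqrt (- poly (D1 t) u) * s$3 - slope t u) / (t$5 - u)])"

lemma continuous_on_slab_map:
  assumes "I \<subseteq> {..<t$5}"
  shows "continuous_on (I \<times> UNIV) (slab_map t)"
  unfolding slab_map_def case_prod_beta slope_def
  using assms by (intro continuous_intros) auto

lemma sphere_3_iff: "s \<in> sphere (0 :: real ^ 3) 1 \<longleftrightarrow> s$1 ^ 2 + s$2 ^ 2 + s$3 ^ 2 = 1"
  by (simp add: norm_vec_def L2_set_def sum_3)

lemma slab_eq_image:
  assumes I: "I \<subseteq> {..<t$5}" "\<And>u. u \<in> I \<Longrightarrow> poly (D1 t) u \<le> 0"
  shows "slab t I = slab_map t ` (I \<times> sphere 0 1)"
proof (intro equalityI subsetI)
  fix x assume "x \<in> slab_map t ` (I \<times> sphere 0 1)"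
  then obtain u s where u: "u \<in> I" and s: "s$1 ^ 2 + s$2 ^ 2 + s$3 ^ 2 = 1"
    and x: "x = slab_map t (u, s)"
    unfolding sphere_3_iff[symmetric] by blast
  have ut: "0 < t$5 - u" and D: "0 \<le> - poly (D1 t) u" using I u by auto
  have x34: "x$3 = 1" "x$4 = u" by (simp_all add: x slab_map_def)
  have "(t$5 - u) * x$1 ^ 2 = - poly (D1 t) u * s$1 ^ 2" "(t$5 - u) * x$2 ^ 2 = - poly (D1 t) u * s$2 ^ 2"
    using ut D by (simp_all add: x slab_map_def power_divide power_mult_distrib)
  moreover have "(t$5 - u) * x$5 + slope t u = sqrt (- poly (D1 t) u) * s$3"
    using ut by (simp add: x slab_map_def)
  then have "((t$5 - u) * x$5 + slope t u) ^ 2 = - poly (D1 t) u * s$3 ^ 2"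
    using D by (simp add: power_mult_distrib)
  ultimately have "(t$5 - u) * (x$1 ^ 2 + x$2 ^ 2) + ((t$5 - u) * x$5 + slope t u) ^ 2
      = - poly (D1 t) u * (s$1 ^ 2 + s$2 ^ 2 + s$3 ^ 2)"
    by (simp add: distrib_left)
  then have "(t$5 - u) * cubic t x = 0"
    using cubic_complete_square[of x t] x34 s by simp
  then show "x \<in> slab t I"
    using ut u x34 by (auto simp: slab_def cone_def vec5_eq_iff)
next
  fix x assume x: "x \<in> slab t I"
  define u where "u = x$4"
  define w where "w = (t$5 - u) * x$5 + slope t u"
  define k where "k = sqrt (- poly (D1 t) u)"
  have u: "u \<in> I" using x by (simp add: u_def slab_def)
  have ut: "0 < t$5 - u" and D: "0 \<le> - poly (D1 t) u" using I u by auto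
  have eq: "(t$5 - u) * (x$1 ^ 2 + x$2 ^ 2) + w ^ 2 = k ^ 2"
    using x D cubic_complete_square[of x t] by (simp add: slab_def cone_def u_def w_def k_def)
  show "x \<in> slab_map t ` (I \<times> sphere 0 1)"
  proof (cases "k = 0")
    \<comment> \<open>The fibre is a single point, hit by every \<open>s\<close>;
      \<open>axis 1 1\<close> is an arbitrary choice.\<close>
    case True
    have "0 \<le> (t$5 - u) * (x$1 ^ 2 + x$2 ^ 2)" using ut by simp
    then have w: "w ^ 2 = 0" "(t$5 - u) * (x$1 ^ 2 + x$2 ^ 2) = 0"
      using eq True zero_le_power2[of w] by (auto simp: add_nonneg_eq_0_iff simp del: zero_le_power2)
    then have "x$1 ^ 2 + x$2 ^ 2 = 0" "(t$5 - u) * x$5 = - slope t u"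
      using ut by (auto simp: w_def)
    then have "x$1 = 0" "x$2 = 0" "x$5 = - slope t u / (t$5 - u)"
      using ut by (auto simp: sum_power2_eq_zero_iff field_simps)
    then have "x = slab_map t (u, axis 1 1)"
      using True x by (simp add: slab_map_def vec5_eq_iff slab_def k_def[symmetric] u_def[symmetric])
    then show ?thesis using u by (auto simp: norm_axis_1)
  next
    case False
    define s :: "real ^ 3" where
      "s = vector [sqrt (t$5 - u) * x$1 / k, sqrt (t$5 - u) * x$2 / k, w / k]"
    have "s$1 ^ 2 + s$2 ^ 2 + s$3 ^ 2 = ((t$5 - u) * (x$1 ^ 2 + x$2 ^ 2) + w ^ 2) / k ^ 2"
      using ut by (simp add: s_def power_divide power_mult_distrib add_divide_distrib distrib_left)
    then have "s \<in> sphere 0 1"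
      unfolding sphere_3_iff eq using False by simp
    moreover have "x = slab_map t (u, s)"
      using False ut x
      by (auto simp: slab_map_def s_def vec5_eq_iff slab_def k_def[symmetric] u_def[symmetric] w_def)
    ultimately show ?thesis using u by blast
  qed
qed

lemma connected_slab:
  assumes "connected I" "I \<subseteq> {..<t$5}" "\<And>u. u \<in> I \<Longrightarrow> poly (D1 t) u \<le> 0"
  shows "connected (slab t I)"
proof -
  have "slab t I = slab_map t ` (I \<times> sphere 0 1)"
    using assms(2,3) by (rule slab_eq_image)
  moreover have "connected \<dots>"
    by (intro connected_continuous_image connected_Times connected_sphere assms(1)
      continuous_on_subset[OF continuous_on_slab_map[OF assms(2)]]) auto
  ultimately show ?thesis by simp
qed

lemma compact_slab:
  assumes "compact I" "I \<subseteq> {..<t$5}" "\<And>u. u \<in> I \<Longrightarrow> poly (D1 t) u \<le> 0"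
  shows "compact (slab t I)"
proof -
  have "slab t I = slab_map t ` (I \<times> sphere 0 1)"
    using assms(2,3) by (rule slab_eq_image)
  moreover have "compact \<dots>"
    by (intro compact_continuous_image compact_Times compact_sphere assms(1)
      continuous_on_subset[OF continuous_on_slab_map[OF assms(2)]]) auto
  ultimately show ?thesis by simp
qed

lemma slab_nonempty:
  assumes "u \<in> I" "I \<subseteq> {..<t$5}" "\<And>u. u \<in> I \<Longrightarrow> poly (D1 t) u \<le> 0"
  shows "slab t I \<noteq> {}"
proof -
  have "slab t I = slab_map t ` (I \<times> sphere 0 1)"
    using assms(2,3) by (rule slab_eq_image)
  then show ?thesis using assms(1) by auto
qed

section \<open>Paths inside slabs and from the fibres to infinity\<close>

lemma connected_component_slab:
  assumes "connected I" "I \<subseteq> {..<t$5}" "\<And>u. u \<in> I \<Longrightarrow> poly (D1 t) u \<le> 0"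
    and "x \<in> slab t I" "y \<in> slab t I"
  shows "connected_component (cone t) x y"
  using connected_slab[OF assms(1,2,3)] assms(4,5)
  unfolding connected_component_def by (intro exI[of _ "slab t I"]) (auto simp: slab_def)

text \<open>With \<open>a = 1 - s\<close> the left side is the cubic along the path below, its first
  bracket being the value of \<open>x$1 ^ 2 + x$2 ^ 2\<close>. For \<open>e * e = 1\<close> it is
  \<open>a^3\<close> times the equation at the start.\<close>

lemma fibre_identity:
  fixes a r s e u v T1 T2 T3 T4 T5 T6 :: real
  shows "(a^2 * r - s * a * (e * (2 * (T5 - u) * v + T6 * u + T3)) + s^2 * (u - T5)) * a
      + T1 * a^3 + a^2 * (T2 * (u * a) + T3 * (a * v + s * e))
      + a * (T4 * (u * a)^2 + T5 * (a * v + s * e)^2 + T6 * (u * a) * (a * v + s * e))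
      + u * a * ((u * a)^2 - (a * v + s * e)^2)
    = a^3 * (r + (u^3 - u * v^2 + T4 * u^2 + T5 * v^2 + T6 * u * v + T2 * u + T3 * v + T1))
      + a * s^2 * (T5 - u) * (e * e - 1)"
  by (simp add: algebra_simps power2_eq_square power3_eq_cube)

text \<open>For \<open>u \<ge> t\<^sub>5\<close> the point moves to infinity inside the fibre over \<open>u\<close>, in the direction
  \<open>e = \<plusminus>1\<close> in which \<open>- g\<close> increases.\<close>

lemma connected_component_far:
  assumes x: "x \<in> cone t" "x$3 = 1" and u: "t$5 \<le> x$4"
  shows "connected_component (cone t) x (axis 1 1)"
proof -
  define u v where "u = x$4" and "v = x$5"
  define w where "w = (t$5 - u) * v + slope t u"
  \<comment> \<open>This sign makes the mixed term of \<open>R\<close> nonnegative.\<close>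
  define e :: real where "e = (if w \<le> 0 then 1 else - 1)"
  define r where "r = sqrt (x$1 ^ 2 + x$2 ^ 2)"
  have r2: "r ^ 2 = x$1 ^ 2 + x$2 ^ 2" by (simp add: r_def)
  have r0: "0 \<le> r" by (simp add: r_def)
  have e: "e * e = 1" "e * w \<le> 0" by (auto simp: e_def)
  \<comment> \<open>A fixed direction in the \<open>(x_1, x_2)\<close>-plane, so that only the
    radius varies; at radius 0 any unit vector does.\<close>
  obtain c1 c2 where c: "c1 ^ 2 + c2 ^ 2 = 1" "x$1 = c1 * r" "x$2 = c2 * r"
  proof (cases "r = 0")
    case True
    then show thesis using r2 that[of 1 0] by (auto simp: sum_power2_eq_zero_iff)
  next
    case False
    have "(x$1 / r) ^ 2 + (x$2 / r) ^ 2 = r ^ 2 / r ^ 2"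
      unfolding r2 power_divide add_divide_distrib ..
    then show thesis using that[of "x$1 / r" "x$2 / r"] False by simp
  qed
  \<comment> \<open>The value of \<open>x$1 ^ 2 + x$2 ^ 2\<close> that satisfies the equation along
    the segment from \<open>(1, u, v)\<close> to \<open>(0, 0, e)\<close> in the last three
    coordinates.\<close>
  define R where "R s = (1 - s) ^ 2 * r ^ 2 - 2 * s * (1 - s) * (e * w) + s ^ 2 * (u - t$5)" for s
  have R_nonneg: "0 \<le> R s" if "s \<in> {0..1}" for s
  proof -
    have "s * (1 - s) * (e * w) \<le> 0"
      using that by (intro mult_nonneg_nonpos[OF _ e(2)]) auto
    moreover have "0 \<le> (1 - s) ^ 2 * r ^ 2" "0 \<le> s ^ 2 * (u - t$5)"
      using u by (simp_all add: u_def)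
    ultimately show ?thesis unfolding R_def by linarith
  qed
  define p :: "real \<Rightarrow> real ^ 5" where
    "p s = vector [c1 * sqrt (R s), c2 * sqrt (R s), 1 - s, u * (1 - s), (1 - s) * v + s * e]" for s
  have cubic0: "r ^ 2 + (u^3 - u * v^2 + t$4 * u^2 + t$5 * v^2 + t$6 * u * v + t$2 * u + t$3 * v + t$1) = 0"
  proof -
    have "cubic t x = 0" using x(1) by (simp add: cone_def)
    then show ?thesis
      unfolding r2 cubic_def x(2) u_def[symmetric] v_def[symmetric]
      by (simp add: algebra_simps power2_eq_square power3_eq_cube)
  qed
  have p_cone: "p s \<in> cone t" if s: "s \<in> {0..1}" for s
  proof -
    have "p s \<noteq> 0"
      using e by (cases "s = 1") (auto simp: p_def vec5_eq_iff)
    moreover have "p s $ 1 ^ 2 + p s $ 2 ^ 2 = (c1 ^ 2 + c2 ^ 2) * R s"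
      using R_nonneg[OF s] by (simp add: p_def power_mult_distrib algebra_simps)
    then have 12: "p s $ 1 ^ 2 + p s $ 2 ^ 2 = R s" by (simp add: c)
    have "cubic t (p s) = (1 - s) ^ 3 * (r ^ 2 + (u^3 - u * v^2 + t$4 * u^2 + t$5 * v^2 + t$6 * u * v + t$2 * u + t$3 * v + t$1))
       + (1 - s) * s^2 * (t$5 - u) * (e * e - 1)"
    proof -
      have "R s = (1 - s) ^ 2 * r ^ 2
          - s * (1 - s) * (e * (2 * (t$5 - u) * v + t$6 * u + t$3)) + s ^ 2 * (u - t$5)"
        by (simp add: R_def w_def slope_def field_simps)
      then show ?thesis
        unfolding fibre_identity[symmetric] cubic_def 12 by (simp add: p_def)
    qed
    then have "cubic t (p s) = 0" unfolding cubic0 e by simp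
    ultimately show ?thesis by (simp add: cone_def)
  qed
  have "connected_component (cone t) (p 0) (p 1)"
  proof (rule connected_componentI_image[where I = "{0..1}" and f = p])
    show "continuous_on {0..1} p"
      unfolding p_def R_def by (intro continuous_intros)
  qed (use p_cone in auto)
  moreover have "p 0 = x"
    using c x(2) r0 by (simp add: p_def R_def vec5_eq_iff u_def v_def)
  moreover have "connected_component (cone t) (p 1) (axis 1 1)"
    by (rule connected_component_infinity) (use p_cone[of 1] in \<open>simp_all add: p_def\<close>)
  ultimately show ?thesis by (metis connected_component_trans)
qed

text \<open>The cubic at \<open>(0, 0, 1, u, v)\<close> is \<open>g(u, v)\<close>, so this is a
  continuous section over the region \<open>g \<le> 0\<close> of the
  \<open>(u, v)\<close>-plane.\<close>

definition lift :: "real ^ 6 \<Rightarrow> real \<Rightarrow> real \<Rightarrow> real ^ 5" where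
  "lift t u v = vector [sqrt (- cubic t (vector [0, 0, 1, u, v])), 0, 1, u, v]"

lemma lift_in_slab:
  assumes "cubic t (vector [0, 0, 1, u, v]) \<le> 0" "u \<in> I"
  shows "lift t u v \<in> slab t I"
  using assms by (simp add: lift_def slab_def cone_def vec5_eq_iff cubic_def)

text \<open>At \<open>u = t$5\<close> the function \<open>g\<close> is linear in \<open>v\<close>
  with nonzero coefficient \<open>t$6 * t$5 + t$3\<close>, so some constant \<open>v\<close> gives a
  section reaching \<open>u = t$5\<close>. The slab leads to that section, and at \<open>t$5\<close>
  \<open>connected_component_far\<close> takes over.\<close>

lemma connected_component_right:
  assumes x: "x \<in> cone t" "x$3 = 1" and gen: "t$6 * t$5 + t$3 \<noteq> 0"
    and u: "x$4 < t$5" and D: "\<And>s. x$4 \<le> s \<Longrightarrow> s \<le> t$5 \<Longrightarrow> poly (D1 t) s \<le> 0"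
  shows "connected_component (cone t) x (axis 1 1)"
proof -
  \<comment> \<open>Solves \<open>g(t5, v) = - 1\<close>.\<close>
  define v where "v = - (1 + t$5 ^ 3 + t$4 * t$5 ^ 2 + t$2 * t$5 + t$1) / (t$6 * t$5 + t$3)"
  let ?h = "\<lambda>s. - cubic t (vector [0, 0, 1, s, v])"
  have "(t$6 * t$5 + t$3) * v = - (1 + t$5 ^ 3 + t$4 * t$5 ^ 2 + t$2 * t$5 + t$1)"
    using gen by (simp add: v_def)
  then have h1: "?h (t$5) = 1"
    by (simp add: cubic_def algebra_simps power2_eq_square power3_eq_cube)
  have cont: "continuous_on UNIV ?h"
    unfolding cubic_def vector_5_nth by (intro continuous_intros)
  then have "open {s. 0 < ?h s}"
    by (rule open_Collect_less[OF continuous_on_const])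
  then obtain \<delta> where \<delta>: "0 < \<delta>" "\<And>s. dist s (t$5) < \<delta> \<Longrightarrow> 0 < ?h s"
    unfolding open_dist using h1 by (metis mem_Collect_eq zero_less_one)
  \<comment> \<open>Close enough to \<open>t$5\<close> for the section to exist, yet not left of
    \<open>x$4\<close>.\<close>
  define a where "a = max (x$4) (t$5 - \<delta> / 2)"
  have a: "x$4 \<le> a" "a < t$5" using u \<delta>(1) by (auto simp: a_def)
  have h: "0 < ?h s" if "s \<in> {a..t$5}" for s
    using that \<delta>(1) by (intro \<delta>(2)) (auto simp: dist_real_def a_def)
  have lift: "lift t s v \<in> slab t {a..t$5}" if "s \<in> {a..t$5}" for s
    using h[OF that] by (intro lift_in_slab that) simp
  have "connected_component (cone t) x (lift t a v)"
  proof (rule connected_component_slab[where I = "{x$4..<t$5}"])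
    show "lift t a v \<in> slab t {x$4..<t$5}"
      using lift[of a] a by (auto simp: slab_def lift_def)
  qed (use x u D in \<open>auto simp: slab_def\<close>)
  moreover have "connected_component (cone t) (lift t a v) (lift t (t$5) v)"
  proof (rule connected_componentI_image[where I = "{a..t$5}" and f = "\<lambda>s. lift t s v"])
    show "continuous_on {a..t$5} (\<lambda>s. lift t s v)"
      unfolding lift_def by (intro continuous_intros continuous_on_subset[OF cont]) auto
  qed (use lift a in \<open>auto simp: slab_def\<close>)
  moreover have "connected_component (cone t) (lift t (t$5) v) (axis 1 1)"
    by (rule connected_component_far) (use lift[of "t$5"] a in \<open>auto simp: slab_def lift_def\<close>)
  ultimately show ?thesis by (metis connected_component_trans)
qed

text \<open>On \<open>v = 0\<close> the function \<open>- g\<close> grows like \<open>- u^3\<close>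
  as \<open>u\<close> tends to minus infinity, so a section runs off to the left; rescaled, it
  converges to \<open>axis 1 1\<close>.\<close>

lemma connected_component_left:
  assumes x: "x \<in> cone t" "x$3 = 1"
    and u: "x$4 < t$5" and D: "\<And>s. s \<le> x$4 \<Longrightarrow> poly (D1 t) s \<le> 0"
  shows "connected_component (cone t) x (axis 1 1)"
proof -
  define h where "h s = - cubic t (vector [0, 0, 1, s, 0])" for s :: real
  have h: "h s = - (s ^ 3) - t$4 * s ^ 2 - t$2 * s - t$1" for s :: real
    by (simp add: h_def cubic_def power2_eq_square power3_eq_cube)
  have "filterlim (\<lambda>s. h s) at_top at_bot" unfolding h by real_asymp
  then have "\<forall>\<^sub>F s in at_bot. 0 < h s" by (simp add: filterlim_at_top_dense)
  then obtain b where b: "\<And>s. s \<le> b \<Longrightarrow> 0 < h s"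
    by (auto simp: eventually_at_bot_linorder)
  define a where "a = min b (x$4)"
  have pos: "0 < h s" if "s \<le> a" for s using b that by (simp add: a_def)
  \<comment> \<open>Dividing by \<open>sqrt (h s)\<close> makes the first coordinate 1; the others
    tend to 0 because \<open>h s\<close> outgrows \<open>s ^ 2\<close>.\<close>
  define p :: "real \<Rightarrow> real ^ 5" where "p s = vector [1, 0, 1 / sqrt (h s), s / sqrt (h s), 0]" for s
  have p: "lift t s 0 \<in> slab t {..a}" "p s = (1 / sqrt (h s)) *s lift t s 0" if "s \<le> a" for s
    using pos[OF that] that
    by (auto intro!: lift_in_slab simp: h_def)
       (auto simp: p_def lift_def vec5_eq_iff h_def)
  have "connected_component (cone t) x (lift t a 0)"
  proof (rule connected_component_slab[where I = "{..x$4}"])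
    show "lift t a 0 \<in> slab t {..x$4}"
      using p(1)[of a] by (auto simp: slab_def lift_def a_def)
  qed (use x u D in \<open>auto simp: slab_def\<close>)
  moreover have "connected_component (cone t) (lift t a 0) (p a)"
    using connected_component_cone_smult[of "lift t a 0" t "1 / sqrt (h a)"] p[of a] pos[of a]
    by (auto simp: slab_def)
  moreover have "connected_component (cone t) (p a) (axis 1 1)"
  proof -
    have "(p \<longlongrightarrow> axis 1 1) at_bot"
    proof (rule vec_tendstoI)
      fix i :: 5
      have "((\<lambda>s. 1 / sqrt (h s)) \<longlongrightarrow> 0) at_bot" "((\<lambda>s. s / sqrt (h s)) \<longlongrightarrow> 0) at_bot"
        unfolding h by real_asymp+
      then show "((\<lambda>s. p s $ i) \<longlongrightarrow> axis 1 1 $ i) at_bot"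
        using exhaust_5[of i] by (auto simp: p_def axis_def)
    qed
    then have lim: "axis 1 1 \<in> closure (p ` {..a})"
    proof (rule Lim_in_closed_set[OF closed_closure, rotated 2])
      show "\<forall>\<^sub>F s in at_bot. p s \<in> closure (p ` {..a})"
        using eventually_le_at_bot[of a] by eventually_elim (rule subsetD[OF closure_subset], simp)
    qed simp
    have "continuous_on {..a} p"
    proof -
      have "continuous_on {..a} h" unfolding h by (intro continuous_intros)
      then show ?thesis unfolding p_def using pos
        by (intro continuous_intros) (auto simp: less_imp_neq[symmetric])
    qed
    then have "connected (p ` {..a})"
      by (intro connected_continuous_image) auto
    then have "connected (insert (axis 1 1) (p ` {..a}))"
      by (rule connected_intermediate_closure)
         (use lim in \<open>auto intro: subsetD[OF closure_subset]\<close>)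
    moreover have "p s \<in> cone t" if "s \<le> a" for s
      using p[OF that] pos[OF that] by (auto simp: slab_def intro: cone_smult)
    moreover have "axis 1 1 \<in> cone t"
      by (auto simp: cone_def cubic_def axis_eq_0_iff) (auto simp: axis_def)
    ultimately show ?thesis
      unfolding connected_component_def by (intro exI[of _ "insert (axis 1 1) (p ` {..a})"]) auto
  qed
  ultimately show ?thesis by (metis connected_component_trans)
qed

subsection \<open>Components of the real locus\<close>

text \<open>A connected set meeting the clopen set \<open>B\<close> lies inside \<open>B\<close>. So
  \<open>A\<close> is disjoint from \<open>B\<close>, and neither can be enlarged to a bigger
  connected set.\<close>

lemma connected_components_of_clopen_pair:
  assumes A: "connectedin X A" and B: "connectedin X B" and AB: "A \<union> B = topspace X"
    and clopen: "openin X B" "closedin X B" and ne: "B \<noteq> {}" "\<not> A \<subseteq> B"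
  shows "connected_components_of X = {A, B}" and "A \<noteq> B"
proof -
  have sub: "S \<subseteq> B" if "connectedin X S" "S \<inter> B \<noteq> {}" for S
  proof (rule ccontr)
    assume "\<not> S \<subseteq> B"
    moreover have "openin X (topspace X - B)" using clopen(2) by (simp add: closedin_def)
    moreover have "S \<subseteq> topspace X" using that(1) by (rule connectedin_subset_topspace)
    moreover have "B \<inter> (topspace X - B) \<inter> S = {}" by blast
    moreover have "S \<subseteq> B \<union> (topspace X - B)" "B \<inter> S \<noteq> {}" "(topspace X - B) \<inter> S \<noteq> {}"
      using calculation that(2) by blast+
    ultimately show False
      using that(1) clopen(1) unfolding connectedin by blast
  qed
  have disj: "A \<inter> B = {}" using sub[OF A] ne(2) by blast
  have cA: "connected_component_of_set X a = A" if "a \<in> A" for a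
  proof
    have a: "a \<in> connected_component_of_set X a"
      using that AB by (auto simp: connected_component_of_refl)
    have "connected_component_of_set X a \<inter> B = {}"
      using sub[OF connectedin_connected_component_of, of a] a that disj by blast
    then show "connected_component_of_set X a \<subseteq> A"
      using AB connected_component_of_subset_topspace[of X a] by blast
    show "A \<subseteq> connected_component_of_set X a"
      using A that by (rule connected_component_of_maximal)
  qed
  have cB: "connected_component_of_set X b = B" if "b \<in> B" for b
  proof
    have b: "b \<in> connected_component_of_set X b"
      using that AB by (auto simp: connected_component_of_refl)
    show "connected_component_of_set X b \<subseteq> B"
      using sub[OF connectedin_connected_component_of, of b] b that by blast
    show "B \<subseteq> connected_component_of_set X b"
      using B that by (rule connected_component_of_maximal)
  qed
  have "A \<noteq> {}" using ne(2) by auto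
  then show "connected_components_of X = {A, B}"
    unfolding connected_components_of_def AB[symmetric] image_Un using cA cB ne(1) by (auto simp: image_iff)
  show "A \<noteq> B" using ne(2) by auto
qed

section \<open>From the cone to the real threefold\<close>

abbreviation real_threefold :: "real ^ 6 \<Rightarrow> (real ^ 5) set topology" where
  "real_threefold t \<equiv> subtopology real_proj_topology (threefold t)"

lemma threefold_eq: "threefold t = proj_point ` cone t"
  by (simp add: threefold_def cone_def)

lemma topspace_real_threefold: "topspace (real_threefold t) = threefold t"
  by (auto simp: topspace_subtopology topspace_real_proj_topology threefold_def proj_space_def)

lemma connectedin_proj_point_image:
  assumes "connected T" "T \<subseteq> cone t"
  shows "connectedin (real_threefold t) (proj_point ` T)"
proof -
  have "connectedin (top_of_set (- {0})) T"
    using assms by (auto simp: connectedin_subtopology cone_def)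
  then have "connectedin real_proj_topology (proj_point ` T)"
    using quotient_imp_continuous_map[OF quotient_map_proj_point] connectedin_continuous_map_image
    by blast
  then show ?thesis
    using assms(2) by (auto simp: connectedin_subtopology threefold_eq)
qed

text \<open>Scaling invariance makes \<open>S\<close> the full preimage of its image.\<close>

lemma openin_proj_point_image:
  assumes "open S" and inv: "\<And>c x. c \<noteq> 0 \<Longrightarrow> x \<in> S \<Longrightarrow> c *s x \<in> S" and "0 \<notin> S"
  shows "openin real_proj_topology (proj_point ` S)"
proof -
  have "{x. x \<noteq> 0 \<and> proj_point x \<in> proj_point ` S} = S"
    using assms(3) inv by (auto elim!: proj_point_eqD)
  then show ?thesis
    using assms(1,3) by (auto simp: openin_real_proj_topology proj_space_def)
qed

text \<open>The part joined to infinity: it contains every cone point with \<open>x$3 = 0\<close> by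
  \<open>connected_component_infinity\<close>.\<close>

definition core :: "real ^ 6 \<Rightarrow> (real ^ 5) set" where
  "core t = connected_component_set (cone t) (axis 1 1)"

lemma axis_in_core: "axis 1 1 \<in> core t"
  unfolding core_def mem_Collect_eq
  by (rule connected_component_sym, rule connected_component_infinity)
     (auto simp: cone_def cubic_def axis_eq_0_iff, auto simp: axis_def)

lemma core_subset: "core t \<subseteq> cone t"
  unfolding core_def by (rule connected_component_subset)

lemma in_coreI: "connected_component (cone t) x (axis 1 1) \<Longrightarrow> x \<in> core t"
  by (simp add: core_def connected_component_sym)

lemma connectedin_core: "connectedin (real_threefold t) (proj_point ` core t)"
  by (rule connectedin_proj_point_image[OF _ core_subset]) (simp add: core_def)

lemma cone_normalize:
  assumes "x \<in> cone t" "x$3 \<noteq> 0"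
  obtains y where "y \<in> cone t" "y$3 = 1" "y = (1 / x$3) *s x" "proj_point x = proj_point y"
  using assms that[of "(1 / x$3) *s x"] by (simp add: cone_smult proj_point_smult)

lemma threefold_subset:
  assumes "\<And>x. x \<in> cone t \<Longrightarrow> x$3 = 1 \<Longrightarrow> x \<in> core t \<union> S"
  shows "threefold t \<subseteq> proj_point ` core t \<union> proj_point ` S"
proof
  fix p :: "(real ^ 5) set"
  assume "p \<in> threefold t"
  then obtain x where x: "x \<in> cone t" "p = proj_point x" by (auto simp: threefold_eq)
  show "p \<in> proj_point ` core t \<union> proj_point ` S"
  proof (cases "x$3 = 0")
    case True
    then show ?thesis using connected_component_infinity[OF x(1)] x(2) in_coreI by blast
  next
    case False
    then show ?thesis using cone_normalize[OF x(1)] assms x(2) by (metis UnE UnI1 UnI2 imageI)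
  qed
qed

lemma card_components_1:
  assumes "\<And>x. x \<in> cone t \<Longrightarrow> x$3 = 1 \<Longrightarrow> connected_component (cone t) x (axis 1 1)"
  shows "card (connected_components_of (real_threefold t)) = 1"
proof -
  have "threefold t \<subseteq> proj_point ` core t"
    using threefold_subset[of t "{}"] assms in_coreI by auto
  then have "threefold t = proj_point ` core t"
    using core_subset[of t] by (auto simp: threefold_eq)
  then have "connectedin (real_threefold t) (topspace (real_threefold t))"
    unfolding topspace_real_threefold using connectedin_core[of t] by metis
  then have "connected_space (real_threefold t)"
    by (rule connectedin_topspace[THEN iffD1])
  moreover have "threefold t \<noteq> ({} :: (real ^ 5) set set)"
    using axis_in_core[of t] core_subset[of t] by (auto simp: threefold_eq)
  then have "real_threefold t \<noteq> trivial_topology"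
    by (metis topspace_real_threefold topspace_discrete_topology)
  ultimately show ?thesis
    by (simp add: connected_components_of_connected_space)
qed

text \<open>The gaps where \<open>D1 t\<close> is positive isolate the slab over
  \<open>{a..b}\<close> within the affine chart, and compactness isolates it from infinity. So its
  image is clopen, and by \<open>conn\<close> the core covers the rest.\<close>

lemma card_components_2:
  assumes ord: "lo < a" "a \<le> b" "b < hi" "hi < t$5"
    and neg: "\<And>u. a \<le> u \<Longrightarrow> u \<le> b \<Longrightarrow> poly (D1 t) u \<le> 0"
    and pos: "\<And>u. lo \<le> u \<Longrightarrow> u < a \<Longrightarrow> 0 < poly (D1 t) u"
      "\<And>u. b < u \<Longrightarrow> u \<le> hi \<Longrightarrow> 0 < poly (D1 t) u"
    and conn: "\<And>x. x \<in> cone t \<Longrightarrow> x$3 = 1 \<Longrightarrow> x$4 \<notin> {a..b} \<Longrightarrow>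
      connected_component (cone t) x (axis 1 1)"
  shows "card (connected_components_of (real_threefold t)) = 2"
proof -
  let ?K = "slab t {a..b}"
  define B where "B = proj_point ` ?K"
  have K: "compact ?K" "connected ?K" "?K \<noteq> {}"
  proof -
    have "{a..b} \<subseteq> {..<t$5}" "\<And>u. u \<in> {a..b} \<Longrightarrow> poly (D1 t) u \<le> 0" using ord neg by auto
    note sub = this
    show "compact ?K" using compact_slab[OF _ sub] by simp
    show "connected ?K" using connected_slab[OF _ sub] by simp
    show "?K \<noteq> {}" using slab_nonempty[OF _ sub, of a] ord(2) by simp
  qed
  have Kc: "?K \<subseteq> cone t" by (auto simp: slab_def)
  obtain M where M: "\<And>x. x \<in> ?K \<Longrightarrow> norm x \<le> M"
    using compact_imp_bounded[OF K(1)] by (auto simp: bounded_iff)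
  \<comment> \<open>A quadratic form, hence of scaling-invariant sign, negative exactly where
    \<open>x_3 \<noteq> 0\<close> and \<open>lo < x_4 / x_3 < hi\<close>.\<close>
  define q :: "real ^ 5 \<Rightarrow> real" where "q x = (x$4 - lo * x$3) * (x$4 - hi * x$3)" for x
  have q_smult: "q (c *s x) = c ^ 2 * q x" for c x
    by (simp add: q_def algebra_simps power2_eq_square)
  have q_cont: "continuous_on UNIV q"
    unfolding q_def by (intro continuous_intros)
  have q_K: "q x < 0" if "x \<in> ?K" for x
    using that ord by (auto simp: slab_def q_def intro!: mult_pos_neg)
  \<comment> \<open>\<open>D1_slab\<close> leaves no cone point over the gaps, \<open>lo\<close> and
    \<open>hi\<close> included.\<close>
  have K_q: "x \<in> ?K" if "x \<in> cone t" "x$3 = 1" "q x \<le> 0" for x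
  proof -
    have u: "lo \<le> x$4" "x$4 \<le> hi"
      using that(2,3) ord by (auto simp: q_def mult_le_0_iff)
    then have "poly (D1 t) (x$4) \<le> 0"
      using that D1_slab ord by simp
    then show ?thesis
      using u pos that by (force simp: slab_def not_le[symmetric])
  qed
  have in_B: "proj_point x \<in> B" if x: "x \<in> cone t" "q x \<le> 0" "x$3 \<noteq> 0" for x
  proof -
    obtain y where y: "y \<in> cone t" "y$3 = 1" "y = (1 / x$3) *s x" "proj_point x = proj_point y"
      using x(1,3) by (rule cone_normalize)
    then have "q y \<le> 0" using x(2) by (simp add: q_smult mult_nonneg_nonpos)
    then show ?thesis using K_q y by (simp add: B_def)
  qed
  define U where "U = {x. q x < 0}"
  \<comment> \<open>The second set catches the points with \<open>x$3 = x$4 = 0\<close>, where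
    \<open>q\<close> vanishes; the bound \<open>M\<close> keeps it off the slab.\<close>
  define W where "W = {x :: real ^ 5. 0 < q x} \<union> {x. M * \<bar>x$3\<bar> < norm x}"
  have "openin real_proj_topology (proj_point ` U)"
  proof (rule openin_proj_point_image)
    show "open U" unfolding U_def by (rule open_Collect_less[OF q_cont continuous_on_const])
  qed (auto simp: U_def q_smult mult_pos_neg, simp add: q_def)
  moreover have "B = proj_point ` U \<inter> threefold t"
  proof
    show "B \<subseteq> proj_point ` U \<inter> threefold t"
      using q_K Kc by (auto simp: B_def U_def threefold_eq)
    show "proj_point ` U \<inter> threefold t \<subseteq> B"
    proof
      fix p assume "p \<in> proj_point ` U \<inter> threefold t"
      then obtain x y where x: "x \<in> U" "p = proj_point x" and y: "y \<in> cone t" "p = proj_point y"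
        by (auto simp: threefold_eq)
      have "y \<noteq> 0" using y by (simp add: cone_def)
      then obtain c where c: "c \<noteq> 0" "y = c *s x"
        using proj_point_eqD[of y x] x y by metis
      then have "q y < 0" using x by (simp add: q_smult U_def mult_pos_neg)
      moreover from this have "y$3 \<noteq> 0" by (auto simp: q_def mult_less_0_iff)
      ultimately show "p \<in> B" using in_B y by simp
    qed
  qed
  ultimately have "openin (real_threefold t) B"
    by (metis openin_subtopology)
  moreover have "openin real_proj_topology (proj_point ` W)"
  proof (rule openin_proj_point_image)
    show "open W"
      unfolding W_def
      by (intro open_Un open_Collect_less continuous_on_const q_cont continuous_intros)
    show "c *s x \<in> W" if "c \<noteq> 0" "x \<in> W" for c x
    proof -
      have "norm (c *s x) = \<bar>c\<bar> * norm x" by (simp add: scalar_mult_eq_scaleR)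
      then show ?thesis
        using that by (auto simp: W_def q_smult abs_mult mult.left_commute[of M])
    qed
  qed (simp add: W_def q_def)
  moreover have "threefold t - B = proj_point ` W \<inter> threefold t"
  proof
    show "threefold t - B \<subseteq> proj_point ` W \<inter> threefold t"
    proof
      fix p assume p: "p \<in> threefold t - B"
      then obtain x where x: "x \<in> cone t" "p = proj_point x" by (auto simp: threefold_eq)
      have "x \<in> W"
      proof (cases "x$3 = 0")
        case True
        then show ?thesis using x by (auto simp: W_def cone_def)
      next
        case False
        then have "\<not> q x \<le> 0" using in_B[OF x(1)] p x(2) by blast
        then show ?thesis by (simp add: W_def)
      qed
      then show "p \<in> proj_point ` W \<inter> threefold t" using p x by blast
    qed
    have "proj_point x \<notin> B" if "x \<in> W" for x
    proof
      assume "proj_point x \<in> B"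
      then obtain y where y: "y \<in> ?K" "proj_point y = proj_point x" by (auto simp: B_def)
      then have "y \<noteq> 0" by (auto simp: slab_def cone_def)
      then obtain c where c: "c \<noteq> 0" "y = c *s x"
        using proj_point_eqD[OF y(2)] by blast
      have "y$3 = 1" using y by (simp add: slab_def)
      have "c ^ 2 * q x < 0" using q_K[OF y(1)] c by (simp add: q_smult)
      moreover have "\<bar>c\<bar> * norm x \<le> M * (\<bar>c\<bar> * \<bar>x$3\<bar>)"
        using M[OF y(1)] c \<open>y$3 = 1\<close>
        by (simp add: scalar_mult_eq_scaleR flip: abs_mult)
      then have "norm x \<le> M * \<bar>x$3\<bar>" using c(1) by (simp add: mult.left_commute)
      ultimately show False using that by (auto simp: W_def mult_less_0_iff)
    qed
    then show "proj_point ` W \<inter> threefold t \<subseteq> threefold t - B" by blast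
  qed
  ultimately have clopen: "openin (real_threefold t) B" "closedin (real_threefold t) B"
    using Kc unfolding closedin_def topspace_real_threefold
    by (auto simp: openin_subtopology B_def threefold_eq)
  have A: "proj_point ` core t \<union> B = topspace (real_threefold t)"
  proof
    show "proj_point ` core t \<union> B \<subseteq> topspace (real_threefold t)"
      unfolding topspace_real_threefold B_def using Kc core_subset[of t]
      by (auto simp: threefold_eq)
    show "topspace (real_threefold t) \<subseteq> proj_point ` core t \<union> B"
      unfolding topspace_real_threefold B_def
      by (rule threefold_subset) (use conn in_coreI in \<open>auto simp: slab_def\<close>)
  qed
  have "proj_point (axis 1 1) \<notin> B"
  proof
    assume "proj_point (axis 1 1) \<in> B"
    then obtain y where y: "y \<in> ?K" "proj_point y = proj_point (axis 1 1)" by (auto simp: B_def)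
    then have "y \<noteq> 0" by (auto simp: slab_def cone_def)
    then obtain c where "y = c *s axis 1 1"
      using proj_point_eqD[OF y(2)] by blast
    then show False using y(1) by (auto simp: slab_def axis_def)
  qed
  then have "\<not> proj_point ` core t \<subseteq> B" using axis_in_core by blast
  moreover have "connectedin (real_threefold t) B"
    unfolding B_def using K(2) Kc by (rule connectedin_proj_point_image)
  moreover have "B \<noteq> {}" using K(3) by (simp add: B_def)
  ultimately have "connected_components_of (real_threefold t) = {proj_point ` core t, B}"
    "proj_point ` core t \<noteq> B"
    using connected_components_of_clopen_pair[OF connectedin_core _ A clopen] by blast+
  then show ?thesis by simp
qed

section \<open>Roots of \<open>D1\<close> and the number of components\<close>

lemma D1_at_t5: "poly (D1 t) (t$5) = - ((slope t (t$5)) ^ 2)"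
  by (simp add: poly_D1 slope_def field_simps power2_eq_square power3_eq_cube power4_eq_xxxx)

text \<open>Factored, \<open>D1 t\<close> is nonpositive exactly on \<open>{..r1}\<close>,
  \<open>{r2..r3}\<close> and \<open>{r4..}\<close>. Points over the outer ranges are joined to
  infinity; the middle range gives the compact slab.\<close>

lemma four_roots_imp_two_components:
  assumes gen: "t$6 * t$5 + t$3 \<noteq> 0"
    and card: "card {x. poly (D1 t) x = 0} = 4" and less: "\<And>x. poly (D1 t) x = 0 \<Longrightarrow> x < t$5"
  shows "card (connected_components_of (real_threefold t)) = 2"
proof -
  let ?S = "{x. poly (D1 t) x = 0}"
  define xs where "xs = sorted_list_of_set ?S"
  have fin: "finite ?S" using card by (simp add: card_ge_0_finite)
  have xs: "length xs = 4" "sorted xs" "distinct xs" "set xs = ?S"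
    using card fin by (auto simp: xs_def)
  then obtain r1 r2 r3 r4 where "xs = [r1, r2, r3, r4]"
    by (auto simp: eval_nat_numeral length_Suc_conv)
  then have ord: "r1 < r2" "r2 < r3" "r3 < r4" and roots: "?S = {r1, r2, r3, r4}"
    using xs by auto
  have r4: "r4 < t$5" using less roots by auto
  have "D1 t = smult (- 1) ([:- r1, 1:] * [:- r2, 1:] * ([:- r3, 1:] * [:- r4, 1:]))"
  proof (rule poly_eqI_degree_lead_coeff[where n = 4 and A = "{r1, r2, r3, r4}"])
    show "4 \<le> card {r1, r2, r3, r4}" using ord by simp
    show "poly (D1 t) z = poly (smult (- 1) ([:- r1, 1:] * [:- r2, 1:] * ([:- r3, 1:] * [:- r4, 1:]))) z"
      if "z \<in> {r1, r2, r3, r4}" for z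
    proof -
      have "poly (D1 t) z = 0" using that roots by blast
      moreover have "poly (smult (- 1) ([:- r1, 1:] * [:- r2, 1:] * ([:- r3, 1:] * [:- r4, 1:]))) z = 0"
        unfolding poly_smult poly_mult using that by auto
      ultimately show ?thesis by simp
    qed
  qed (simp_all add: D1_def eval_nat_numeral)
  then have D: "poly (D1 t) u = - (((u - r1) * (u - r2)) * ((u - r3) * (u - r4)))" for u
    by (simp add: algebra_simps)
  have pos12: "0 < poly (D1 t) u" if "r1 < u" "u < r2" for u
    unfolding D neg_0_less_iff_less using that ord
    by (intro mult_neg_pos mult_pos_neg mult_neg_neg) auto
  have pos34: "0 < poly (D1 t) u" if "r3 < u" "u < r4" for u
    unfolding D neg_0_less_iff_less using that ord
    by (intro mult_pos_neg mult_pos_pos) auto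
  show ?thesis
  \<comment> \<open>\<open>lo\<close> and \<open>hi\<close> are the midpoints of the two
    gaps.\<close>
  proof (rule card_components_2[where lo = "(r1 + r2) / 2" and a = r2 and b = r3 and hi = "(r3 + r4) / 2"])
    show "poly (D1 t) u \<le> 0" if "r2 \<le> u" "u \<le> r3" for u
      unfolding D using that ord
      by (simp add: mult_nonneg_nonneg mult_nonpos_nonpos)
    show "0 < poly (D1 t) u" if "(r1 + r2) / 2 \<le> u" "u < r2" for u
      using that ord by (intro pos12) auto
    show "0 < poly (D1 t) u" if "r3 < u" "u \<le> (r3 + r4) / 2" for u
      using that ord by (intro pos34) auto
    fix x assume x: "x \<in> cone t" "x$3 = 1" "x$4 \<notin> {r2..r3}"
    show "connected_component (cone t) x (axis 1 1)"
    proof (cases "x$4 < t$5")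
      case False
      then show ?thesis using connected_component_far[OF x(1,2)] by simp
    next
      case True
      then have "poly (D1 t) (x$4) \<le> 0" using D1_slab[OF x(1,2)] by simp
      then have "x$4 \<le> r1 \<or> r4 \<le> x$4"
        using x(3) pos12[of "x$4"] pos34[of "x$4"] by force
      then show ?thesis
      proof
        assume u: "x$4 \<le> r1"
        have "poly (D1 t) s \<le> 0" if "s \<le> x$4" for s
          unfolding D using that ord u by (simp add: mult_nonpos_nonpos)
        then show ?thesis using connected_component_left[OF x(1,2) True] by blast
      next
        assume u: "r4 \<le> x$4"
        have "poly (D1 t) s \<le> 0" if "x$4 \<le> s" for s
          unfolding D using that ord u by simp
        then show ?thesis using connected_component_right[OF x(1,2) gen True] by blast
      qed
    qed
  qed (use ord r4 in auto)
qed

text \<open>Over a point cut off from infinity, \<open>u < t$5\<close> and \<open>D1 t\<close> takes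
  positive values on both sides of \<open>u\<close> before \<open>t$5\<close>. It is negative at
  minus infinity and at \<open>t$5\<close>, so the signs run - + - + - and give four roots below
  \<open>t$5\<close>; the degree admits no more.\<close>

lemma not_connected_imp_four_roots:
  assumes gen: "t$6 * t$5 + t$3 \<noteq> 0" "D1_discriminant t \<noteq> 0"
    and x: "x \<in> cone t" "x$3 = 1" "\<not> connected_component (cone t) x (axis 1 1)"
  shows "card {x. poly (D1 t) x = 0} = 4" and "\<And>r. poly (D1 t) r = 0 \<Longrightarrow> r < t$5"
proof -
  let ?S = "{x. poly (D1 t) x = 0}"
  let ?D = "poly (D1 t)"
  define u where "u = x$4"
  have ut: "u < t$5"
    using connected_component_far[OF x(1,2)] x(3) by (auto simp: u_def not_le[symmetric])
  have Du: "?D u \<le> 0"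
    using D1_slab[OF x(1,2)] ut by (simp add: u_def)
  obtain b where b: "u \<le> b" "b \<le> t$5" "0 < ?D b"
    using connected_component_right[OF x(1,2) gen(1)] x(3) ut
    by (auto simp: u_def not_le[symmetric])
  obtain a where a: "a \<le> u" "0 < ?D a"
    using connected_component_left[OF x(1,2)] x(3) ut
    by (auto simp: u_def not_le[symmetric])
  have Dt: "?D (t$5) < 0"
    using gen(1) by (simp add: D1_at_t5 slope_def)
  have ab: "a < u" "u < b" "b < t$5"
    using a b Du Dt by (auto simp: less_le)
  \<comment> \<open>If \<open>u\<close> is itself a root, it is simple, so \<open>D1 t\<close> is
    negative just to one side of \<open>u\<close>; halving the minimum keeps \<open>w\<close>
    between \<open>a\<close> and \<open>b\<close>.\<close>
  obtain w where w: "a < w" "w < b" "?D w < 0"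
  proof (cases "?D u = 0")
    case False
    then show thesis using that[of u] ab Du by simp
  next
    case True
    then have nz: "poly (pderiv (D1 t)) u \<noteq> 0" using D1_simple_roots[OF gen(2)] by simp
    show thesis
    proof (cases "0 < poly (pderiv (D1 t)) u")
      case pos: True
      obtain d where d: "0 < d" "\<And>h. 0 < h \<Longrightarrow> h < d \<Longrightarrow> ?D (u - h) < ?D u"
        using DERIV_pos_inc_left[OF poly_DERIV pos] by blast
      show thesis
        using that[of "u - min d (u - a) / 2"] d(2)[of "min d (u - a) / 2"] d(1) ab True
        by (auto simp: min_def field_simps split: if_splits)
    next
      case False
      then have neg: "poly (pderiv (D1 t)) u < 0" using nz by simp
      obtain d where d: "0 < d" "\<And>h. 0 < h \<Longrightarrow> h < d \<Longrightarrow> ?D (u + h) < ?D u"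
        using DERIV_neg_dec_right[OF poly_DERIV neg] by blast
      show thesis
        using that[of "u + min d (b - u) / 2"] d(2)[of "min d (b - u) / 2"] d(1) ab True
        by (auto simp: min_def field_simps split: if_splits)
    qed
  qed
  have "filterlim (\<lambda>s. ?D s) at_bot at_bot"
    unfolding poly_D1 by real_asymp
  then have "\<forall>\<^sub>F s in at_bot. ?D s < 0" by (simp add: filterlim_at_bot_dense)
  then obtain z where z: "z < a" "?D z < 0"
  proof -
    assume ev: "\<forall>\<^sub>F s in at_bot. ?D s < 0"
      and *: "\<And>z. z < a \<Longrightarrow> ?D z < 0 \<Longrightarrow> thesis"
    obtain N where "\<And>s. s \<le> N \<Longrightarrow> ?D s < 0"
      using ev by (auto simp: eventually_at_bot_linorder)
    then show thesis using *[of "min N (a - 1)"] by simp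
  qed
  obtain r1 where r1: "z < r1" "r1 < a" "?D r1 = 0"
    using poly_IVT_pos[of z a "D1 t"] z a by blast
  obtain r2 where r2: "a < r2" "r2 < w" "?D r2 = 0"
    using poly_IVT_neg[of a w "D1 t"] w a by blast
  obtain r3 where r3: "w < r3" "r3 < b" "?D r3 = 0"
    using poly_IVT_pos[of w b "D1 t"] w b by blast
  obtain r4 where r4: "b < r4" "r4 < t$5" "?D r4 = 0"
    using poly_IVT_neg[of b "t$5" "D1 t"] ab b Dt by blast
  have sub: "{r1, r2, r3, r4} \<subseteq> ?S" and card4: "card {r1, r2, r3, r4} = 4"
    using r1 r2 r3 r4 by auto
  have "card ?S \<le> 4" using card_poly_roots_bound[OF D1_nz, of t] by (simp add: degree_D1)
  then have S: "?S = {r1, r2, r3, r4}"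
    using card_seteq[OF poly_roots_finite[OF D1_nz] sub] card4 by simp
  show "card ?S = 4" using S card4 by simp
  show "r < t$5" if "?D r = 0" for r
  proof -
    have "r \<in> {r1, r2, r3, r4}" using that S by blast
    then show ?thesis using ab r1 r2 r3 r4 w by auto
  qed
qed

text \<open>Off the hypersurface \<open>exceptional t = 0\<close>, either every point joins infinity
  and there is one component, or some point does not, and then the root pattern holds and gives
  exactly two.\<close>

theorem lemma3p8:
  shows "\<exists>Z :: (real ^ 6) set. zariski_closed Z \<and> Z \<noteq> UNIV \<and>
    (\<forall>t. t \<notin> Z \<longrightarrow>
       general_position t \<and>
       (card (connected_components_of (subtopology real_proj_topology (threefold t))) = 2 \<longleftrightarrow>
        card {x. poly (D1 t) x = 0} = 4 \<and> (\<forall>x. poly (D1 t) x = 0 \<longrightarrow> x < t$5)))"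
proof (intro exI[of _ "{t. exceptional t = 0}"] conjI allI impI)
  show "zariski_closed {t. exceptional t = 0}"
    unfolding zariski_closed_def using exceptional_polynomial
    by (intro exI[of _ "{exceptional}"]) auto
  show "{t. exceptional t = 0} \<noteq> UNIV"
    using exceptional_nonzero by auto
  fix t :: "real ^ 6" assume "t \<notin> {t. exceptional t = 0}"
  then have gen: "t$6 * t$5 + t$3 \<noteq> 0" "D1_discriminant t \<noteq> 0"
    by (auto simp: exceptional_def)
  show "general_position t" using gen by (rule general_positionI)
  show "card (connected_components_of (real_threefold t)) = 2 \<longleftrightarrow>
      card {x. poly (D1 t) x = 0} = 4 \<and> (\<forall>x. poly (D1 t) x = 0 \<longrightarrow> x < t$5)"
  proof
    assume "card (connected_components_of (real_threefold t)) = 2"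
    then have "card (connected_components_of (real_threefold t)) \<noteq> 1" by simp
    then obtain x where "x \<in> cone t" "x$3 = 1" "\<not> connected_component (cone t) x (axis 1 1)"
      using card_components_1[of t] by blast
    then show "card {x. poly (D1 t) x = 0} = 4 \<and> (\<forall>x. poly (D1 t) x = 0 \<longrightarrow> x < t$5)"
      using not_connected_imp_four_roots[OF gen] by blast
  next
    assume "card {x. poly (D1 t) x = 0} = 4 \<and> (\<forall>x. poly (D1 t) x = 0 \<longrightarrow> x < t$5)"
    then show "card (connected_components_of (real_threefold t)) = 2"
      using four_roots_imp_two_components[OF gen(1)] by blast
  qed
qed

end
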